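(* Let $X$ and $Y$ be Polish spaces, $\pi\colon X\to Y$ continuous, $L\colon X\to\overline{\mathbb R}_+$ lower semicontinuous, $H\colon X\times X\to\overline{\mathbb R}_+$ Borel measurable, and $m_0\in\mathcal P(Y)$. Assume that: (i) $H(x,\tilde x)=H(\tilde x,x)$ for all $(x,\tilde x)\in X\times X$; (ii) the function $(x,\tilde x)\mapsto L(x)+L(\tilde x)+H(x,\tilde x)$ is lower semicontinuous on $X\times X$; (iii) there exists $\kappa>0$ such that for every $y\in Y$ there exists $x\in X$ with $\pi(x)=y$ and $L(x)\le\kappa$; (iv) for every $\kappa>0$, the set $\{x\in X : L(x)\le\kappa\}$ is compact; (v) there exists $C>0$ such that $H(x,\tilde x)\le C(L(x)+L(\tilde x)+1)$ for all $(x,\tilde x)\in X\times X$. Then a measure $Q_0\in\mathcal P_{m_0}(X)$ is an equilibrium of the game $\mathrm{NAG}(X,Y,\pi,L,H,m_0)$ if and only if it is a critical point of $\mathcal J$ in $\mathcal P_{m_0}(X)$. As a consequence, any local minimizer $Q_0\in\operatorname{dom}\mathcal J$ of $\mathcal J$ in $\mathcal P_{m_0}(X)$ is an equilibrium of $\mathrm{NAG}(X,Y,\pi,L,H,m_0)$.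
   Context: $\overline{\mathbb R}_+=[0,+\infty]$. For a Polish space $X$, $\mathcal P(X)$ is the set of Borel probability measures on $X$ with the topology of weak convergence of measures; $\pi_\#Q$ denotes the pushforward. $\mathcal P_{m_0}(X)=\{Q\in\mathcal P(X):\pi_\#Q=m_0\}$. The domain of an $\overline{\mathbb R}_+$-valued function is the set where it is finite. Individual cost: $F(x,Q)=L(x)+\int_X H(x,\tilde x)\,\mathrm dQ(\tilde x)$ for $x\in X$, $Q\in\mathcal P(X)$. Potential: $\mathcal J(Q)=\int_{X\times X}\bigl(L(x)+L(\tilde x)+H(x,\tilde x)\bigr)\,\mathrm d(Q\otimes Q)(x,\tilde x)\in\overline{\mathbb R}_+$. Equilibrium: $Q\in\mathcal P(X)$ is an equilibrium of $\mathrm{NAG}(X,Y,\pi,L,H,m_0)$ if $\pi_\#Q=m_0$, $\int_X F(x,Q)\,\mathrm dQ(x)<+\infty$, and for $Q$-almost every $x\in X$ one has $F(x,Q)=\inf\{F(z,Q): z\in X,\ \pi(z)=\pi(x)\}$. Differentiability: for $Q_0\in\operatorname{dom}\mathcal J$, $\mathcal J$ is differentiable at $Q_0$ if there exists a Borel-measurable $G\colon X\to[-\infty,+\infty]$ such that, for every $Q\in\operatorname{dom}\mathcal J$, $G$ is $(Q-Q_0)$-integrable (meaning integrable with respect to both $Q$ and $Q_0$, with $\int G\,\mathrm d(Q-Q_0)=\int G\,\mathrm dQ-\int G\,\mathrm dQ_0$) and $$\lim_{t\to0^+}\frac{\mathcal J(Q_0+t(Q-Q_0))-\mathcal J(Q_0)}{t}=\int_X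 G(x)\,\mathrm d(Q-Q_0)(x).$$ Such a $G$ is denoted $\frac{\delta\mathcal J}{\delta Q}(Q_0)$, and the right-hand side is denoted $\langle\frac{\delta\mathcal J}{\delta Q}(Q_0),Q-Q_0\rangle$. Critical point: $Q_0\in\operatorname{dom}\mathcal J\cap\mathcal P_{m_0}(X)$ is a critical point of $\mathcal J$ in $\mathcal P_{m_0}(X)$ if $\mathcal J$ is differentiable at $Q_0$ and $\langle\frac{\delta\mathcal J}{\delta Q}(Q_0),Q-Q_0\rangle\ge0$ for every $Q\in\operatorname{dom}\mathcal J\cap\mathcal P_{m_0}(X)$. Local minimizer: $Q_0\in\mathcal P_{m_0}(X)$ for which there is a neighborhood $V$ of $Q_0$ in $\mathcal P_{m_0}(X)$ (weak convergence topology) with $\mathcal J(Q)\ge\mathcal J(Q_0)$ for every $Q\in V$. *)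

theory Defs
  imports "HOL-Probability.Probability"
begin

section \<open>Semicontinuity and the space of probability measures\<close>

definition lower_semicontinuous :: "('a::topological_space \<Rightarrow> ennreal) \<Rightarrow> bool" where
  "lower_semicontinuous f \<longleftrightarrow> (\<forall>a. open {x. a < f x})"

definition prob_measures :: "'a::topological_space measure set" where
  "prob_measures = space (prob_algebra borel)"

lemma mem_prob_measures: "Q \<in> prob_measures \<longleftrightarrow> sets Q = sets borel \<and> prob_space Q"
  by (simp add: prob_measures_def space_prob_algebra)

definition prob_measures_over ::
    "('a::topological_space \<Rightarrow> 'b::topological_space) \<Rightarrow> 'b measure \<Rightarrow> 'a measure set" where
  "prob_measures_over \<pi> m\<^sub>0 = {Q \<in> prob_measures. distr Q borel \<pi> = m\<^sub>0}"

text \<open>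
  The coarsest topology on the Borel probability measures that makes
  \<open>Q \<mapsto> \<integral>f dQ\<close> continuous for every bounded continuous real \<open>f\<close>.
\<close>

definition weak_topology :: "'a::topological_space measure topology" where
  "weak_topology = topology_generated_by
     {{Q \<in> prob_measures. (\<integral>x. f x \<partial>Q) \<in> U} | (f :: 'a \<Rightarrow> real) U.
        continuous_on UNIV f \<and> bounded (range f) \<and> open U}"

lemma topspace_weak_topology: "topspace weak_topology = prob_measures"
proof -
  have "\<exists>(f :: 'a \<Rightarrow> real) U. prob_measures = {Q \<in> prob_measures. (\<integral>x. f x \<partial>Q) \<in> U} \<and>
          continuous_on UNIV f \<and> bounded (range f) \<and> open U"
    by (intro exI[of _ "\<lambda>_. 0"] exI[of _ UNIV]) auto
  then show ?thesis
    unfolding weak_topology_def topology_generated_by_topspace by blast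
qed

section \<open>The game and its potential\<close>

definition individual_cost ::
    "('a \<Rightarrow> ennreal) \<Rightarrow> ('a \<Rightarrow> 'a \<Rightarrow> ennreal) \<Rightarrow> 'a \<Rightarrow> 'a measure \<Rightarrow> ennreal" where
  "individual_cost L H x Q = L x + (\<integral>\<^sup>+ z. H x z \<partial>Q)"

definition nag_equilibrium ::
    "('a::topological_space \<Rightarrow> 'b::topological_space) \<Rightarrow> ('a \<Rightarrow> ennreal) \<Rightarrow> ('a \<Rightarrow> 'a \<Rightarrow> ennreal) \<Rightarrow>
     'b measure \<Rightarrow> 'a measure \<Rightarrow> bool" where
  "nag_equilibrium \<pi> L H m\<^sub>0 Q \<longleftrightarrow>
     Q \<in> prob_measures \<and> distr Q borel \<pi> = m\<^sub>0 \<and>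
     (\<integral>\<^sup>+ x. individual_cost L H x Q \<partial>Q) < \<infinity> \<and>
     (AE x in Q. individual_cost L H x Q = (INF z \<in> {z. \<pi> z = \<pi> x}. individual_cost L H z Q))"

definition potential ::
    "('a \<Rightarrow> ennreal) \<Rightarrow> ('a \<Rightarrow> 'a \<Rightarrow> ennreal) \<Rightarrow> 'a measure \<Rightarrow> ennreal" where
  "potential L H Q = (\<integral>\<^sup>+ (x, z). L x + L z + H x z \<partial>(Q \<Otimes>\<^sub>M Q))"

section \<open>Differentiability, critical points and local minimizers\<close>

definition dom_prob :: "('a::topological_space measure \<Rightarrow> ennreal) \<Rightarrow> 'a measure set" where
  "dom_prob J = {Q \<in> prob_measures. J Q < \<infinity>}"

text \<open>
  The measure \<open>Q\<^sub>0 + t (Q - Q\<^sub>0)\<close>, which is only meaningful for \<open>0 \<le> t \<le> 1\<close>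
  (\<open>ennreal\<close> truncates negative coefficients to zero).
\<close>

definition segment_measure :: "'a measure \<Rightarrow> 'a measure \<Rightarrow> real \<Rightarrow> 'a measure" where
  "segment_measure Q\<^sub>0 Q t = measure_of (space Q\<^sub>0) (sets Q\<^sub>0)
     (\<lambda>A. ennreal (1 - t) * emeasure Q\<^sub>0 A + ennreal t * emeasure Q A)"

lemma sets_segment_measure [simp, measurable_cong]:
  "sets (segment_measure Q\<^sub>0 Q t) = sets Q\<^sub>0"
  by (simp add: segment_measure_def)

lemma emeasure_segment_measure:
  assumes "sets Q = sets Q\<^sub>0" "A \<in> sets Q\<^sub>0"
  shows "emeasure (segment_measure Q\<^sub>0 Q t) A =
           ennreal (1 - t) * emeasure Q\<^sub>0 A + ennreal t * emeasure Q A"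
proof -
  let ?\<mu> = "\<lambda>A. ennreal (1 - t) * emeasure Q\<^sub>0 A + ennreal t * emeasure Q A"
  have "countably_additive (sets Q\<^sub>0) ?\<mu>"
  proof (rule countably_additiveI)
    fix A :: "nat \<Rightarrow> 'a set"
    assume "range A \<subseteq> sets Q\<^sub>0" "disjoint_family A"
    then show "(\<Sum>i. ?\<mu> (A i)) = ?\<mu> (\<Union> (range A))"
      using assms(1) by (simp flip: suminf_add add: suminf_emeasure)
  qed
  then show ?thesis
    unfolding segment_measure_def
    by (intro emeasure_measure_of_sigma) (auto simp: assms positive_def sets.sigma_algebra_axioms)
qed

lemma segment_measure_in_prob_measures:
  assumes "Q\<^sub>0 \<in> prob_measures" "Q \<in> prob_measures" "0 \<le> t" "t \<le> 1"
  shows "segment_measure Q\<^sub>0 Q t \<in> prob_measures"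
proof -
  have sets: "sets Q\<^sub>0 = sets borel" "sets Q = sets borel"
    and prob: "prob_space Q\<^sub>0" "prob_space Q"
    using assms by (auto simp: mem_prob_measures)
  have space: "space Q\<^sub>0 = UNIV" "space Q = UNIV" "space (segment_measure Q\<^sub>0 Q t) = UNIV"
    using sets[THEN sets_eq_imp_space_eq] sets_eq_imp_space_eq[OF sets_segment_measure[of Q\<^sub>0 Q t]]
    by simp_all
  have "emeasure (segment_measure Q\<^sub>0 Q t) UNIV = 1"
    using prob[THEN prob_space.emeasure_space_1] sets assms(3,4)
    by (simp add: emeasure_segment_measure space flip: ennreal_plus)
  then show ?thesis
    by (auto simp: mem_prob_measures sets space intro: prob_spaceI)
qed

text \<open>
  Integrability of an extended-real-valued function: \<open>\<integral>|G| dQ < \<infinity>\<close>. Such a \<open>G\<close> is finite almost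
  everywhere, so its integral is the Bochner integral of \<open>real_of_ereal \<circ> G\<close>. Finiteness of the
  integral of \<open>|G|\<close> has to be required separately, because \<open>real_of_ereal\<close> maps \<open>\<plusminus>\<infinity>\<close> to \<open>0\<close>.
\<close>

definition ereal_integrable :: "'a measure \<Rightarrow> ('a \<Rightarrow> ereal) \<Rightarrow> bool" where
  "ereal_integrable M G \<longleftrightarrow>
     G \<in> borel_measurable M \<and> (\<integral>\<^sup>+ x. e2ennreal \<bar>G x\<bar> \<partial>M) < \<infinity>"

definition ereal_integral :: "'a measure \<Rightarrow> ('a \<Rightarrow> ereal) \<Rightarrow> real" where
  "ereal_integral M G = (\<integral>x. real_of_ereal (G x) \<partial>M)"

definition pairing :: "('a \<Rightarrow> ereal) \<Rightarrow> 'a measure \<Rightarrow> 'a measure \<Rightarrow> real" where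
  "pairing G Q Q\<^sub>0 = ereal_integral Q G - ereal_integral Q\<^sub>0 G"

text \<open>
  \<open>G\<close> is a version of \<open>\<delta>J/\<delta>Q(Q\<^sub>0)\<close>. The difference quotient is extended real, since \<open>J\<close> may
  a priori be infinite in the interior of the segment.
\<close>

definition has_flat_derivative ::
    "('a::topological_space measure \<Rightarrow> ennreal) \<Rightarrow> 'a measure \<Rightarrow> ('a \<Rightarrow> ereal) \<Rightarrow> bool" where
  "has_flat_derivative J Q\<^sub>0 G \<longleftrightarrow>
     Q\<^sub>0 \<in> dom_prob J \<and> G \<in> borel_measurable borel \<and>
     (\<forall>Q \<in> dom_prob J.
        ereal_integrable Q G \<and> ereal_integrable Q\<^sub>0 G \<and>
        ((\<lambda>t. (enn2ereal (J (segment_measure Q\<^sub>0 Q t)) - enn2ereal (J Q\<^sub>0)) / ereal t)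
           \<longlongrightarrow> ereal (pairing G Q Q\<^sub>0)) (at_right 0))"

text \<open>
  The derivative is not unique as a function, but its pairing with \<open>Q - Q\<^sub>0\<close> is, being a limit;
  the existential quantifier below is therefore unambiguous.
\<close>

definition critical_point ::
    "('a::topological_space measure \<Rightarrow> ennreal) \<Rightarrow> 'a measure set \<Rightarrow> 'a measure \<Rightarrow> bool" where
  "critical_point J P Q\<^sub>0 \<longleftrightarrow>
     Q\<^sub>0 \<in> dom_prob J \<inter> P \<and>
     (\<exists>G. has_flat_derivative J Q\<^sub>0 G \<and> (\<forall>Q \<in> dom_prob J \<inter> P. 0 \<le> pairing G Q Q\<^sub>0))"

definition local_minimizer ::
    "('a::topological_space measure \<Rightarrow> ennreal) \<Rightarrow> 'a measure set \<Rightarrow> 'a measure \<Rightarrow> bool" where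
  "local_minimizer J P Q\<^sub>0 \<longleftrightarrow>
     Q\<^sub>0 \<in> P \<and>
     (\<exists>V. openin (subtopology weak_topology P) V \<and> Q\<^sub>0 \<in> V \<and> (\<forall>Q \<in> V. J Q\<^sub>0 \<le> J Q))"

end

theory Submission
  imports Defs
begin

text \<open>
  The potential is the quadratic form of the symmetric kernel \<open>k(x, z) = L(x) + L(z) + H(x, z)\<close>, so
  its flat derivative at \<open>Q\<^sub>0\<close> is \<open>2 \<integral> k(x, z) dQ\<^sub>0(z)\<close>, which is \<open>2 F(x, Q\<^sub>0)\<close> up to a finite
  constant. Hence \<open>Q\<^sub>0\<close> is critical iff it minimises the linear functional
  \<open>Q \<mapsto> \<integral> F(x, Q\<^sub>0) dQ(x)\<close> among the measures with marginal \<open>m\<^sub>0\<close> and finite potential.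

  By Fatou's lemma \<open>F(\<sqdot>, Q\<^sub>0)\<close> is lower semicontinuous, with compact sublevel sets because
  \<open>L \<le> F\<close>. Therefore the value \<open>v(y) = inf {F(z, Q\<^sub>0) | \<pi>(z) = y}\<close> is attained, and it is lower
  semicontinuous since its sublevel sets are the images under \<open>\<pi>\<close> of those of \<open>F(\<sqdot>, Q\<^sub>0)\<close>. Every
  admissible \<open>Q\<close> satisfies \<open>\<integral> F(x, Q\<^sub>0) dQ(x) \<ge> \<integral> v dm\<^sub>0\<close>, with equality for the push-forward of
  \<open>m\<^sub>0\<close> along a measurable selection of minimisers; so \<open>Q\<^sub>0\<close> is critical iff
  \<open>F(x, Q\<^sub>0) = v(\<pi>(x))\<close> for \<open>Q\<^sub>0\<close>-almost every \<open>x\<close>.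
\<close>

section \<open>Lower semicontinuous functions\<close>

lemma lower_semicontinuous_closed:
  "lower_semicontinuous f \<Longrightarrow> closed {x. f x \<le> a}"
  by (simp add: lower_semicontinuous_def closed_def Compl_eq not_le)

lemma lower_semicontinuous_measurable:
  "lower_semicontinuous f \<Longrightarrow> f \<in> borel_measurable borel"
  by (rule borel_measurableI_greater) (simp add: lower_semicontinuous_def)

lemma lower_semicontinuous_Pair:
  assumes "lower_semicontinuous (\<lambda>(x, z). k x z)"
  shows "lower_semicontinuous (k x)"
  unfolding lower_semicontinuous_def
proof
  fix a
  have "{z. a < k x z} = Pair x -` {p. a < (case p of (x, z) \<Rightarrow> k x z)}"
    by auto
  also have "open \<dots>"
    using assms unfolding lower_semicontinuous_def
    by (intro open_vimage) (auto intro!: continuous_intros)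
  finally show "open {z. a < k x z}" .
qed

text \<open>The first variable ranges over a metric space, so closedness of the sublevel sets can be
  tested on sequences. Along a convergent sequence, joint lower semicontinuity bounds the limit
  integrand by the \<open>liminf\<close> of the integrands, and Fatou's lemma carries this over to
  the integrals.\<close>

lemma lower_semicontinuous_nn_integral:
  fixes k :: "'a::metric_space \<Rightarrow> 'b::topological_space \<Rightarrow> ennreal"
  assumes k: "lower_semicontinuous (\<lambda>(x, z). k x z)" and Q: "sets Q = sets borel"
  shows "lower_semicontinuous (\<lambda>x. \<integral>\<^sup>+ z. k x z \<partial>Q)"
proof -
  have meas: "k x \<in> borel_measurable Q" for x
    using lower_semicontinuous_measurable[OF lower_semicontinuous_Pair[OF k]]
    by (simp add: measurable_cong_sets[OF Q refl])
  have "closed {x. (\<integral>\<^sup>+ z. k x z \<partial>Q) \<le> a}" for a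
    unfolding closed_sequential_limits
  proof (intro allI impI, elim conjE)
    fix X x
    assume X: "\<forall>n. X n \<in> {x. (\<integral>\<^sup>+ z. k x z \<partial>Q) \<le> a}" and lim: "X \<longlonglongrightarrow> x"
    have "k x z \<le> liminf (\<lambda>n. k (X n) z)" for z
      unfolding le_Liminf_iff
    proof (intro allI impI)
      fix c assume "c < k x z"
      have "(\<lambda>n. (X n, z)) \<longlonglongrightarrow> (x, z)"
        by (intro tendsto_intros lim)
      moreover have "open {p. c < (case p of (x, z) \<Rightarrow> k x z)}"
        using k by (simp add: lower_semicontinuous_def)
      ultimately show "\<forall>\<^sub>F n in sequentially. c < k (X n) z"
        using \<open>c < k x z\<close> by (auto dest: topological_tendstoD)
    qed
    then have "(\<integral>\<^sup>+ z. k x z \<partial>Q) \<le> (\<integral>\<^sup>+ z. liminf (\<lambda>n. k (X n) z) \<partial>Q)"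
      by (intro nn_integral_mono)
    also have "\<dots> \<le> liminf (\<lambda>n. \<integral>\<^sup>+ z. k (X n) z \<partial>Q)"
      by (rule nn_integral_liminf) (rule meas)
    also have "\<dots> \<le> liminf (\<lambda>n. a)"
      using X by (intro Liminf_mono always_eventually) auto
    finally show "x \<in> {x. (\<integral>\<^sup>+ z. k x z \<partial>Q) \<le> a}"
      by (simp add: Liminf_const)
  qed
  then show ?thesis
    by (simp add: lower_semicontinuous_def closed_def Compl_eq not_le)
qed

lemma decseq_compact_nonempty:
  fixes K :: "nat \<Rightarrow> 'a::t2_space set"
  assumes "\<And>n. compact (K n)" "\<And>n. K n \<noteq> {}" "\<And>n. K (Suc n) \<subseteq> K n"
  shows "(\<Inter>n. K n) \<noteq> {}"
proof -
  have mono: "m \<le> n \<Longrightarrow> K n \<subseteq> K m" for m n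
    using assms(3) by (rule lift_Suc_antimono_le)
  have "K 0 \<inter> (\<Inter>n\<in>UNIV. K n) \<noteq> {}"
  proof (rule compact_imp_fip_image)
    fix I :: "nat set" assume "finite I"
    \<comment> \<open>Inserting \<open>0\<close> makes \<open>Max\<close> meaningful for empty
      \<open>I\<close> and keeps the witness inside \<open>K 0\<close>.\<close>
    then have "K (Max (insert 0 I)) \<subseteq> K n" if "n \<in> insert 0 I" for n
      using that by (intro mono Max_ge) auto
    then have "K (Max (insert 0 I)) \<subseteq> K 0 \<inter> (\<Inter>n\<in>I. K n)"
      by blast
    then show "K 0 \<inter> (\<Inter>n\<in>I. K n) \<noteq> {}"
      using assms(2) by blast
  qed (auto simp: assms compact_imp_closed)
  then show ?thesis by blast
qed

text \<open>The closed sets \<open>D \<inter> {x. f x \<le> r}\<close>, with \<open>r\<close>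
  strictly above the infimum, satisfy the finite intersection property inside one compact sublevel
  set; a common point is a minimiser. Finiteness of the infimum provides that compact level and
  rules out an empty \<open>D\<close>.\<close>

lemma lower_semicontinuous_attains_inf:
  assumes f: "lower_semicontinuous f" and cpt: "\<And>a. a < \<top> \<Longrightarrow> compact {x. f x \<le> a}"
    and D: "closed D" and fin: "(INF x\<in>D. f x) < \<top>"
  obtains x where "x \<in> D" "f x = (INF x\<in>D. f x)"
proof -
  define v where "v = (INF x\<in>D. f x)"
  obtain b where b: "v < b" "b < \<top>"
    using dense[OF fin] unfolding v_def by blast
  have "{x. f x \<le> b} \<inter> (\<Inter>r\<in>{v<..<\<top>}. D \<inter> {x. f x \<le> r}) \<noteq> {}"
  proof (rule compact_imp_fip_image)
    fix I assume I: "finite I" "I \<subseteq> {v<..<\<top>}"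
    \<comment> \<open>Inserting \<open>b\<close> makes \<open>Min\<close> meaningful for empty
      \<open>I\<close> and keeps the witness in the compact sublevel set.\<close>
    define r where "r = Min (insert b I)"
    have "v < r" using I b by (auto simp: r_def)
    then obtain x where x: "x \<in> D" "f x < r"
      unfolding v_def INF_less_iff by blast
    have "r \<le> s" if "s \<in> insert b I" for s
      using I that by (simp add: r_def)
    then have "f x \<le> s" if "s \<in> insert b I" for s
      using x(2) that by (meson less_imp_le order.trans)
    then have "x \<in> {x. f x \<le> b} \<inter> (\<Inter>r\<in>I. D \<inter> {x. f x \<le> r})"
      using x(1) by auto
    then show "{x. f x \<le> b} \<inter> (\<Inter>r\<in>I. D \<inter> {x. f x \<le> r}) \<noteq> {}" by blast
  next
    show "compact {x. f x \<le> b}" using cpt[OF b(2)] .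
  next
    fix r show "closed (D \<inter> {x. f x \<le> r})" by (intro closed_Int D lower_semicontinuous_closed[OF f])
  qed
  then obtain x where "x \<in> {x. f x \<le> b} \<inter> (\<Inter>r\<in>{v<..<\<top>}. D \<inter> {x. f x \<le> r})"
    by (auto simp only: ex_in_conv[symmetric])
  then have x: "x \<in> D \<and> f x \<le> r" if "v < r" "r < \<top>" for r
    using that by (simp only: INT_iff Int_iff mem_Collect_eq greaterThanLessThan_iff)
  have "f x \<le> v"
  proof (rule dense_ge)
    fix r assume "v < r"
    then show "f x \<le> r"
      using x[of r] top.not_eq_extremum[of r] by (cases "r = \<top>") auto
  qed
  moreover have "v \<le> f x"
    using x[OF b] unfolding v_def by (auto intro: INF_lower)
  ultimately show ?thesis
    using that x[OF b] by (auto simp: v_def)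
qed

text \<open>Since finite infima over closed fibres are attained, a sublevel set at a finite level is
  the continuous image of a compact set. The closed set \<open>D\<close> is kept general because the
  selection argument compares minima over \<open>D\<close> with minima over whole fibres.\<close>

lemma lower_semicontinuous_fibre_inf:
  fixes \<pi> :: "'a::t2_space \<Rightarrow> 'b::t2_space"
  assumes \<pi>: "continuous_on UNIV \<pi>"
    and f: "lower_semicontinuous f" and cpt: "\<And>a. a < \<top> \<Longrightarrow> compact {x. f x \<le> a}"
    and D: "closed D"
  shows "lower_semicontinuous (\<lambda>y. INF x\<in>{x\<in>D. \<pi> x = y}. f x)"
proof -
  have "closed {y. (INF x\<in>{x\<in>D. \<pi> x = y}. f x) \<le> a}" for a
  proof (cases "a < \<top>")
    case True
    have "{y. (INF x\<in>{x\<in>D. \<pi> x = y}. f x) \<le> a} = \<pi> ` ({x. f x \<le> a} \<inter> D)"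
    proof (intro set_eqI iffI)
      fix y assume y: "y \<in> {y. (INF x\<in>{x\<in>D. \<pi> x = y}. f x) \<le> a}"
      have "closed (D \<inter> \<pi> -` {y})"
        using \<pi> D by (intro closed_Int closed_vimage) auto
      also have "D \<inter> \<pi> -` {y} = {x\<in>D. \<pi> x = y}" by auto
      finally have closed: "closed {x\<in>D. \<pi> x = y}" .
      have fin: "(INF x\<in>{x\<in>D. \<pi> x = y}. f x) < \<top>"
        using y True by auto
      obtain x where "x \<in> {x\<in>D. \<pi> x = y}" "f x = (INF x\<in>{x\<in>D. \<pi> x = y}. f x)"
        by (rule lower_semicontinuous_attains_inf[OF f _ closed fin]) (rule cpt)
      then show "y \<in> \<pi> ` ({x. f x \<le> a} \<inter> D)"
        using y by auto
    next
      fix y assume "y \<in> \<pi> ` ({x. f x \<le> a} \<inter> D)"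
      then obtain x where "x \<in> {x\<in>D. \<pi> x = y}" "f x \<le> a" by blast
      then have "(INF x\<in>{x\<in>D. \<pi> x = y}. f x) \<le> a"
        by (rule INF_lower2)
      then show "y \<in> {y. (INF x\<in>{x\<in>D. \<pi> x = y}. f x) \<le> a}" ..
    qed
    also have "closed \<dots>"
      by (rule compact_imp_closed[OF compact_continuous_image[OF continuous_on_subset[OF \<pi>]]])
        (use cpt[OF True] D in \<open>auto intro: compact_Int_closed\<close>)
    finally show ?thesis .
  next
    case False
    then have "a = \<top>"
      using top.not_eq_extremum by blast
    then show ?thesis by simp
  qed
  then show ?thesis
    by (simp add: lower_semicontinuous_def closed_def Compl_eq not_le)
qed

section \<open>Measurable selections\<close>

text \<open>
  The values of \<open>\<Phi>\<close> are cut down, stage by stage, to the first ball of radius \<open>1/2^n\<close> around a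
  dense sequence that they meet. In the limit a single point survives.
\<close>

lemma measurable_selection:
  fixes \<Phi> :: "'b \<Rightarrow> 'a::{metric_space, second_countable_topology} set"
  assumes compact: "\<And>y. y \<in> space M \<Longrightarrow> compact (\<Phi> y)"
    and nonempty: "\<And>y. y \<in> space M \<Longrightarrow> \<Phi> y \<noteq> {}"
    and meas: "\<And>C. closed C \<Longrightarrow> {y \<in> space M. \<Phi> y \<inter> C \<noteq> {}} \<in> sets M"
  obtains S where "S \<in> borel_measurable M" "\<forall>y \<in> space M. S y \<in> \<Phi> y"
proof -
  obtain D :: "'a set" where D: "countable D" "\<And>X. open X \<Longrightarrow> X \<noteq> {} \<Longrightarrow> \<exists>d\<in>D. d \<in> X"
    using countable_dense_exists by blast
  define d where "d = from_nat_into D"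
  have "D \<noteq> {}" using D(2)[OF open_UNIV] by auto
  then have range_d: "range d = D"
    using D(1) by (simp add: d_def range_from_nat_into)
  define B where "B n k = cball (d k) (1 / 2 ^ n)" for n k :: nat
  have closed_B: "closed (B n k)" for n k
    by (simp add: B_def)
  \<comment> \<open>\<open>LEAST\<close> carries information only when some ball is met; density of
    the centres ensures this for every nonempty \<open>A\<close>.\<close>
  define first where "first n A = (LEAST k. A \<inter> B n k \<noteq> {})" for n and A :: "'a set"
  define \<Psi> where "\<Psi> n y = rec_nat (\<Phi> y) (\<lambda>n A. A \<inter> B n (first n A)) n" for n y
  have \<Psi>_0: "\<Psi> 0 y = \<Phi> y" and \<Psi>_Suc: "\<Psi> (Suc n) y = \<Psi> n y \<inter> B n (first n (\<Psi> n y))" for n y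
    by (simp_all add: \<Psi>_def)
  have first: "A \<inter> B n (first n A) \<noteq> {}" if A: "A \<noteq> {}" for n A
  proof -
    obtain a where a: "a \<in> A" using A by blast
    have "a \<in> ball a (1 / 2 ^ n)"
      by simp
    then have "ball a (1 / 2 ^ n) \<noteq> {}"
      by blast
    from D(2)[OF open_ball this] obtain k where "d k \<in> ball a (1 / 2 ^ n)"
      unfolding range_d[symmetric] by blast
    then have "A \<inter> B n k \<noteq> {}" using a by (auto simp: B_def dist_commute)
    then show ?thesis unfolding first_def by (rule LeastI)
  qed
  have cpt: "compact (\<Psi> n y)" and ne: "\<Psi> n y \<noteq> {}" if "y \<in> space M" for n y
    using that
    by (induction n) (auto simp: \<Psi>_0 \<Psi>_Suc compact nonempty first closed_B intro!: compact_Int_closed)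
  \<comment> \<open>The closed set must stay arbitrary in the induction: stage \<open>Suc n\<close>
    meets \<open>C\<close> iff stage \<open>n\<close> meets \<open>B n k \<inter> C\<close>, where
    \<open>k\<close> is the index selected at stage \<open>n\<close>, and only countably many
    \<open>k\<close> occur.\<close>
  have hit: "{y \<in> space M. \<Psi> n y \<inter> C \<noteq> {}} \<in> sets M" if "closed C" for n C
    using that
  proof (induction n arbitrary: C)
    case (Suc n)
    have B: "{y \<in> space M. \<Psi> n y \<inter> B n k \<noteq> {}} \<in> sets M" for k
      by (rule Suc.IH[OF closed_B])
    \<comment> \<open>This turns the choice of an index into a finite Boolean combination of hitting
      conditions, each measurable by the induction hypothesis.\<close>
    have *: "first n A = k \<longleftrightarrow> A \<inter> B n k \<noteq> {} \<and> (\<forall>j<k. \<not> A \<inter> B n j \<noteq> {})" if "A \<noteq> {}" for A k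
    proof
      assume "first n A = k"
      then show "A \<inter> B n k \<noteq> {} \<and> (\<forall>j<k. \<not> A \<inter> B n j \<noteq> {})"
        using first[OF that, of n] not_less_Least[of _ "\<lambda>k. A \<inter> B n k \<noteq> {}"]
        unfolding first_def by metis
    next
      assume k: "A \<inter> B n k \<noteq> {} \<and> (\<forall>j<k. \<not> A \<inter> B n j \<noteq> {})"
      show "first n A = k"
        unfolding first_def
      proof (rule Least_equality)
        show "k \<le> j" if "A \<inter> B n j \<noteq> {}" for j
          using k that by (meson not_le)
      qed (use k in simp)
    qed
    have first_meas: "{y \<in> space M. first n (\<Psi> n y) = k} \<in> sets M" for k
    proof -
      have "{y \<in> space M. first n (\<Psi> n y) = k} =
        {y \<in> space M. \<Psi> n y \<inter> B n k \<noteq> {}} \<inter>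
        (\<Inter>j<k. space M - {y \<in> space M. \<Psi> n y \<inter> B n j \<noteq> {}}) \<inter> space M"
      proof (rule set_eqI, cases)
        fix y assume "y \<in> space M"
        with *[OF ne[OF this, of n], of k] show "y \<in> {y \<in> space M. first n (\<Psi> n y) = k} \<longleftrightarrow>
            y \<in> {y \<in> space M. \<Psi> n y \<inter> B n k \<noteq> {}} \<inter>
            (\<Inter>j<k. space M - {y \<in> space M. \<Psi> n y \<inter> B n j \<noteq> {}}) \<inter> space M"
          by auto
      qed auto
      \<comment> \<open>For \<open>k = 0\<close> the intersection over \<open>j\<close> is the
        universe, so this case is split off from intersections over nonempty index sets.\<close>
      also have "\<dots> \<in> sets M"
        using B by (cases "k = 0") (auto intro!: sets.Int sets.finite_INT sets.Diff)
      finally show ?thesis .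
    qed
    have "{y \<in> space M. \<Psi> (Suc n) y \<inter> C \<noteq> {}} =
        (\<Union>k. {y \<in> space M. first n (\<Psi> n y) = k} \<inter> {y \<in> space M. \<Psi> n y \<inter> (B n k \<inter> C) \<noteq> {}})"
      by (auto simp: \<Psi>_Suc)
    also have "\<dots> \<in> sets M"
      by (intro sets.countable_UN subsetI, elim rangeE)
        (simp add: Suc.IH Suc.prems first_meas closed_B closed_Int sets.Int)
    finally show ?case .
  qed (simp add: \<Psi>_0 meas)
  define S where "S y = (SOME x. x \<in> (\<Inter>n. \<Psi> n y))" for y
  have S: "S y \<in> \<Psi> n y" if "y \<in> space M" for y n
  proof -
    have "(\<Inter>n. \<Psi> n y) \<noteq> {}"
      using that by (intro decseq_compact_nonempty cpt ne) (auto simp: \<Psi>_Suc)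
    then have "S y \<in> (\<Inter>n. \<Psi> n y)"
      unfolding S_def some_in_eq .
    then show ?thesis by blast
  qed
  have unique: "x = S y" if y: "y \<in> space M" and x: "\<And>n. x \<in> \<Psi> n y" for x y
  proof -
    \<comment> \<open>Both points survive stage \<open>Suc n\<close>, hence lie in the same ball of
      radius \<open>1 / 2 ^ n\<close>.\<close>
    have "dist x (S y) \<le> 2 * (1 / 2) ^ n" for n
      using x[of "Suc n"] S[OF y, of "Suc n"] dist_triangle3[of x "S y" "d (first n (\<Psi> n y))"]
      by (simp add: \<Psi>_Suc B_def power_one_over)
    moreover have "(\<lambda>n. 2 * (1 / 2) ^ n :: real) \<longlonglongrightarrow> 2 * 0"
      by (intro tendsto_mult tendsto_const LIMSEQ_power_zero) simp
    ultimately have "dist x (S y) \<le> 2 * 0"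
      by (intro LIMSEQ_le_const[of "\<lambda>n. 2 * (1 / 2) ^ n"]) blast+
    then show ?thesis by simp
  qed
  show ?thesis
  proof (rule that)
    show "S \<in> borel_measurable M"
      unfolding borel_eq_closed
    proof (rule measurable_measure_of)
      fix C :: "'a set" assume "C \<in> Collect closed"
      then have C: "closed C" by simp
      \<comment> \<open>If every stage meets \<open>C\<close>, the decreasing compact sets
        \<open>\<Psi> n y \<inter> C\<close> have a common point, which by uniqueness is
        \<open>S y\<close>.\<close>
      have "S -` C \<inter> space M = (\<Inter>n. {y \<in> space M. \<Psi> n y \<inter> C \<noteq> {}})"
      proof (intro set_eqI iffI)
        fix y assume y: "y \<in> (\<Inter>n. {y \<in> space M. \<Psi> n y \<inter> C \<noteq> {}})"
        then have "(\<Inter>n. \<Psi> n y \<inter> C) \<noteq> {}"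
          using C by (intro decseq_compact_nonempty compact_Int_closed cpt) (auto simp: \<Psi>_Suc)
        then show "y \<in> S -` C \<inter> space M"
          using unique[of y] y by auto
      qed (use S in blast)
      also have "\<dots> \<in> sets M"
        using hit[OF C] by (intro sets.countable_INT) auto
      finally show "S -` C \<inter> space M \<in> sets M" .
    qed auto
    show "\<forall>y \<in> space M. S y \<in> \<Phi> y"
      using S[of _ 0] by (simp add: \<Psi>_0)
  qed
qed

section \<open>Segments of measures\<close>

lemma nn_integral_segment_measure:
  assumes "sets Q = sets Q\<^sub>0" "f \<in> borel_measurable Q\<^sub>0"
  shows "(\<integral>\<^sup>+ x. f x \<partial>segment_measure Q\<^sub>0 Q t) =
    ennreal (1 - t) * (\<integral>\<^sup>+ x. f x \<partial>Q\<^sub>0) + ennreal t * (\<integral>\<^sup>+ x. f x \<partial>Q)"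
  using assms(2)
proof induction
  case (cong f g)
  have "space Q = space Q\<^sub>0" "space (segment_measure Q\<^sub>0 Q t) = space Q\<^sub>0"
    using sets_eq_imp_space_eq[OF assms(1)]
      sets_eq_imp_space_eq[OF sets_segment_measure[of Q\<^sub>0 Q t]] by simp_all
  then have "(\<integral>\<^sup>+ x. f x \<partial>M) = (\<integral>\<^sup>+ x. g x \<partial>M)" if "M \<in> {Q, Q\<^sub>0, segment_measure Q\<^sub>0 Q t}" for M
    using cong(3) that by (intro nn_integral_cong) auto
  then show ?case
    using cong(4) by simp
next
  case (set A)
  then show ?case
    using assms(1) by (simp add: emeasure_segment_measure)
next
  case (mult u c)
  have [measurable]: "u \<in> borel_measurable Q" "u \<in> borel_measurable Q\<^sub>0"
    "u \<in> borel_measurable (segment_measure Q\<^sub>0 Q t)"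
    using mult.hyps by (simp_all add: measurable_cong_sets[OF assms(1) refl]
        measurable_cong_sets[OF sets_segment_measure refl])
  show ?case
    by (simp add: nn_integral_cmult mult distrib_left mult.left_commute)
next
  case (add u v)
  have [measurable]: "u \<in> borel_measurable Q" "u \<in> borel_measurable Q\<^sub>0"
    "u \<in> borel_measurable (segment_measure Q\<^sub>0 Q t)"
    "v \<in> borel_measurable Q" "v \<in> borel_measurable Q\<^sub>0"
    "v \<in> borel_measurable (segment_measure Q\<^sub>0 Q t)"
    using add.hyps by (simp_all add: measurable_cong_sets[OF assms(1) refl]
        measurable_cong_sets[OF sets_segment_measure refl])
  show ?case
    by (simp add: nn_integral_add add distrib_left ac_simps)
next
  case (seq U)
  have [measurable]: "U i \<in> borel_measurable Q" "U i \<in> borel_measurable Q\<^sub>0"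
    "U i \<in> borel_measurable (segment_measure Q\<^sub>0 Q t)" for i
    using seq.hyps by (simp_all add: measurable_cong_sets[OF assms(1) refl]
        measurable_cong_sets[OF sets_segment_measure refl])
  \<comment> \<open>Suprema of increasing sequences add, which recombines the two weighted integrals
    in the limit.\<close>
  have inc: "incseq (\<lambda>i. c * (\<integral>\<^sup>+ x. U i x \<partial>M))" for c M
    using seq(3) by (auto simp: incseq_def le_fun_def intro!: mult_left_mono nn_integral_mono)
  show ?case
    using seq(3) inc
    by (simp add: image_comp nn_integral_monotone_convergence_SUP seq SUP_mult_left_ennreal
        ennreal_SUP_add)
qed

text \<open>Reduces to the nonnegative case through positive and negative parts, whose integrals are
  finite because \<open>f\<close> is bounded. Such integrals define the subbasic weakly open
  sets.\<close>

lemma integral_segment_measure: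
  fixes f :: "'a::topological_space \<Rightarrow> real"
  assumes Q: "Q\<^sub>0 \<in> prob_measures" "Q \<in> prob_measures" and t: "0 \<le> t" "t \<le> 1"
    and f: "f \<in> borel_measurable borel" "bounded (range f)"
  shows "(\<integral>x. f x \<partial>segment_measure Q\<^sub>0 Q t) = (1 - t) * (\<integral>x. f x \<partial>Q\<^sub>0) + t * (\<integral>x. f x \<partial>Q)"
proof -
  obtain b where b: "\<And>x. \<bar>f x\<bar> \<le> b"
    using f(2) by (auto simp: bounded_iff)
  define pos where "pos M = enn2real (\<integral>\<^sup>+ x. ennreal (f x) \<partial>M)" for M
  define neg where "neg M = enn2real (\<integral>\<^sup>+ x. ennreal (- f x) \<partial>M)" for M
  have int: "(\<integral>x. f x \<partial>M) = pos M - neg M"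
    and fin: "(\<integral>\<^sup>+ x. ennreal (f x) \<partial>M) < \<top>" "(\<integral>\<^sup>+ x. ennreal (- f x) \<partial>M) < \<top>"
    if "M \<in> prob_measures" for M
  proof -
    interpret prob_space M using that by (simp add: mem_prob_measures)
    have "f \<in> borel_measurable M"
      using f(1) that by (subst measurable_cong_sets[of M borel]) (auto simp: mem_prob_measures)
    then have "integrable M f"
      using b by (intro integrable_const_bound[of _ b]) auto
    then show "(\<integral>x. f x \<partial>M) = pos M - neg M"
      "(\<integral>\<^sup>+ x. ennreal (f x) \<partial>M) < \<top>" "(\<integral>\<^sup>+ x. ennreal (- f x) \<partial>M) < \<top>"
      by (auto simp: real_lebesgue_integral_def pos_def neg_def real_integrable_def less_top)
  qed
  have meas: "(\<lambda>x. ennreal (g x)) \<in> borel_measurable Q\<^sub>0" if "g \<in> borel_measurable borel" for g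
    using Q(1) that by (subst measurable_cong_sets[of Q\<^sub>0 borel]) (auto simp: mem_prob_measures)
  have sets: "sets Q = sets Q\<^sub>0" using Q by (simp add: mem_prob_measures)
  have "pos (segment_measure Q\<^sub>0 Q t) = (1 - t) * pos Q\<^sub>0 + t * pos Q"
    "neg (segment_measure Q\<^sub>0 Q t) = (1 - t) * neg Q\<^sub>0 + t * neg Q"
    using t fin[OF Q(1)] fin[OF Q(2)] f(1) unfolding pos_def neg_def
    by (simp_all add: nn_integral_segment_measure[OF sets meas] enn2real_plus enn2real_mult ennreal_mult_less_top)
  then show ?thesis
    by (simp add: int Q segment_measure_in_prob_measures t algebra_simps)
qed

text \<open>By induction on how \<open>T\<close> is generated, only subbasic sets need an argument.
  There the tested integral is affine in \<open>t\<close>, so it stays in the open set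
  \<open>U\<close> for small \<open>t\<close>.\<close>

lemma segment_measure_tendsto:
  assumes Q: "Q\<^sub>0 \<in> prob_measures" "Q \<in> prob_measures"
    and T: "openin weak_topology T" "Q\<^sub>0 \<in> T"
  shows "\<forall>\<^sub>F t in at_right 0. segment_measure Q\<^sub>0 Q t \<in> T"
  using openin_topology_generated_by[OF T(1)[unfolded weak_topology_def]] T(2)
proof induction
  case (UN K)
  then obtain k where "k \<in> K" "\<forall>\<^sub>F t in at_right 0. segment_measure Q\<^sub>0 Q t \<in> k" by blast
  then show ?case by (auto elim: eventually_mono)
next
  case (Basis s)
  then obtain f :: "'a \<Rightarrow> real" and U where s: "s = {Q \<in> prob_measures. (\<integral>x. f x \<partial>Q) \<in> U}"
    and f: "continuous_on UNIV f" "bounded (range f)" and U: "open U"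
    by blast
  have "((\<lambda>t. (1 - t) * (\<integral>x. f x \<partial>Q\<^sub>0) + t * (\<integral>x. f x \<partial>Q)) \<longlongrightarrow>
      (1 - 0) * (\<integral>x. f x \<partial>Q\<^sub>0) + 0 * (\<integral>x. f x \<partial>Q)) (at_right 0)"
    by (intro tendsto_intros)
  then have "\<forall>\<^sub>F t in at_right 0. (1 - t) * (\<integral>x. f x \<partial>Q\<^sub>0) + t * (\<integral>x. f x \<partial>Q) \<in> U"
    using Basis(2) by (intro topological_tendstoD[OF _ U]) (auto simp: s)
  moreover have "\<forall>\<^sub>F t in at_right (0::real). t \<in> {0<..<1}"
    by (rule eventually_at_right_real) simp
  ultimately show ?case
    by eventually_elim
      (use f in \<open>auto simp: s integral_segment_measure Q borel_measurable_continuous_onI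
        intro: segment_measure_in_prob_measures[OF Q]\<close>)
qed (auto intro: eventually_conj)

text \<open>Push-forward is linear in the measure and the two weights add up to 1, so prescribing
  the marginal is a convex constraint.\<close>

lemma segment_measure_in_prob_measures_over:
  assumes \<pi>: "\<pi> \<in> borel_measurable borel"
    and Q: "Q\<^sub>0 \<in> prob_measures_over \<pi> m" "Q \<in> prob_measures_over \<pi> m" and t: "0 \<le> t" "t \<le> 1"
  shows "segment_measure Q\<^sub>0 Q t \<in> prob_measures_over \<pi> m"
proof -
  have prob: "Q\<^sub>0 \<in> prob_measures" "Q \<in> prob_measures"
    and distr: "distr Q\<^sub>0 borel \<pi> = m" "distr Q borel \<pi> = m"
    using Q by (auto simp: prob_measures_over_def)
  have S: "segment_measure Q\<^sub>0 Q t \<in> prob_measures"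
    by (rule segment_measure_in_prob_measures[OF prob t])
  have push: "emeasure (distr R borel \<pi>) A = emeasure R (\<pi> -` A)"
    if "R \<in> prob_measures" "A \<in> sets borel" for R A
  proof -
    have R: "sets R = sets borel" using that by (simp add: mem_prob_measures)
    then show ?thesis
      using that(2) \<pi> sets_eq_imp_space_eq[OF R]
      by (subst emeasure_distr) (auto simp: measurable_cong_sets[OF R refl])
  qed
  have "distr (segment_measure Q\<^sub>0 Q t) borel \<pi> = m"
  proof (rule measure_eqI)
    show "sets (distr (segment_measure Q\<^sub>0 Q t) borel \<pi>) = sets m"
      using distr by auto
    fix A assume "A \<in> sets (distr (segment_measure Q\<^sub>0 Q t) borel \<pi>)"
    then have A: "A \<in> sets borel" by simp
    have "\<pi> -` A \<in> sets Q\<^sub>0"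
      using measurable_sets[OF \<pi> A] prob by (simp add: mem_prob_measures)
    then have "emeasure (distr (segment_measure Q\<^sub>0 Q t) borel \<pi>) A =
        ennreal (1 - t) * emeasure Q\<^sub>0 (\<pi> -` A) + ennreal t * emeasure Q (\<pi> -` A)"
      using prob by (simp add: push[OF S A] emeasure_segment_measure mem_prob_measures)
    also have "\<dots> = (ennreal (1 - t) + ennreal t) * emeasure m A"
      using push[OF prob(1) A] push[OF prob(2) A] by (simp add: distr distrib_right)
    also have "\<dots> = emeasure m A"
      using t by (simp flip: ennreal_plus)
    finally show "emeasure (distr (segment_measure Q\<^sub>0 Q t) borel \<pi>) A = emeasure m A" .
  qed
  with S show ?thesis by (simp add: prob_measures_over_def)
qed

section \<open>The energy of a symmetric kernel\<close>

text \<open>The bilinear form behind the potential. With the second measure frozen it is a linear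
  functional of the first.\<close>

definition energy :: "('a \<Rightarrow> 'a \<Rightarrow> ennreal) \<Rightarrow> 'a measure \<Rightarrow> 'a measure \<Rightarrow> ennreal" where
  "energy k P Q = (\<integral>\<^sup>+ x. \<integral>\<^sup>+ z. k x z \<partial>Q \<partial>P)"

lemma borel_measurable_pair_borel:
  fixes f :: "'a::second_countable_topology \<Rightarrow> 'b::second_countable_topology \<Rightarrow> ennreal"
  assumes f: "(\<lambda>(x, z). f x z) \<in> borel_measurable borel"
    and "sets P = sets borel" "sets Q = sets borel"
  shows "(\<lambda>(x, z). f x z) \<in> borel_measurable (P \<Otimes>\<^sub>M Q)"
proof -
  have "sets (P \<Otimes>\<^sub>M Q) = sets (borel :: ('a \<times> 'b) measure)"
    using sets_pair_measure_cong[OF assms(2,3)] by (simp only: borel_prod)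
  then show ?thesis
    using f measurable_cong_sets by blast
qed

locale symmetric_kernel =
  fixes k :: "'a::second_countable_topology \<Rightarrow> 'a \<Rightarrow> ennreal"
  assumes kernel_measurable: "(\<lambda>(x, z). k x z) \<in> borel_measurable borel"
    and kernel_sym: "k x z = k z x"
begin

lemma kernel_measurable_pair:
  assumes "P \<in> prob_measures" "Q \<in> prob_measures"
  shows "(\<lambda>(x, z). k x z) \<in> borel_measurable (P \<Otimes>\<^sub>M Q)"
  using assms by (intro borel_measurable_pair_borel kernel_measurable) (auto simp: mem_prob_measures)

lemma kernel_integral_measurable:
  assumes "P \<in> prob_measures" "Q \<in> prob_measures"
  shows "(\<lambda>x. \<integral>\<^sup>+ z. k x z \<partial>Q) \<in> borel_measurable P"
proof -
  interpret Q: prob_space Q using assms by (simp add: mem_prob_measures)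
  show ?thesis
    by (rule Q.borel_measurable_nn_integral[OF kernel_measurable_pair[OF assms]])
qed

text \<open>Tonelli's theorem exchanges the integrals, and symmetry of the kernel exchanges its
  arguments back.\<close>

lemma energy_commute:
  assumes "P \<in> prob_measures" "Q \<in> prob_measures"
  shows "energy k P Q = energy k Q P"
proof -
  interpret P: prob_space P using assms by (simp add: mem_prob_measures)
  interpret Q: prob_space Q using assms by (simp add: mem_prob_measures)
  interpret pair_sigma_finite P Q ..
  have "energy k P Q = (\<integral>\<^sup>+ z. \<integral>\<^sup>+ x. k x z \<partial>P \<partial>Q)"
    unfolding energy_def by (rule Fubini'[OF kernel_measurable_pair[OF assms], symmetric])
  then show ?thesis
    unfolding energy_def by (subst (asm) kernel_sym)
qed

lemma nn_integral_pair_eq_energy: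
  assumes "P \<in> prob_measures" "Q \<in> prob_measures"
  shows "(\<integral>\<^sup>+ (x, z). k x z \<partial>(P \<Otimes>\<^sub>M Q)) = energy k P Q"
proof -
  interpret Q: prob_space Q using assms by (simp add: mem_prob_measures)
  show ?thesis
    using Q.nn_integral_fst[OF kernel_measurable_pair[OF assms]] by (simp add: energy_def)
qed

lemma energy_segment:
  assumes Q: "Q\<^sub>0 \<in> prob_measures" "Q \<in> prob_measures" and t: "0 \<le> t" "t \<le> 1"
    and fin: "energy k Q\<^sub>0 Q\<^sub>0 < \<top>" "energy k Q Q\<^sub>0 < \<top>" "energy k Q Q < \<top>"
  shows "energy k (segment_measure Q\<^sub>0 Q t) (segment_measure Q\<^sub>0 Q t) =
    ennreal ((1 - t)\<^sup>2 * enn2real (energy k Q\<^sub>0 Q\<^sub>0) + 2 * t * (1 - t) * enn2real (energy k Q Q\<^sub>0) +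
      t\<^sup>2 * enn2real (energy k Q Q))"
proof -
  let ?S = "segment_measure Q\<^sub>0 Q t"
  have S: "?S \<in> prob_measures"
    by (rule segment_measure_in_prob_measures[OF Q t])
  have left: "energy k ?S R = ennreal (1 - t) * energy k Q\<^sub>0 R + ennreal t * energy k Q R"
    if "R \<in> prob_measures" for R
    unfolding energy_def using Q that
    by (intro nn_integral_segment_measure kernel_integral_measurable) (auto simp: mem_prob_measures)
  define a b c where "a = enn2real (energy k Q\<^sub>0 Q\<^sub>0)" "b = enn2real (energy k Q Q\<^sub>0)"
    "c = enn2real (energy k Q Q)"
  have nn: "0 \<le> a" "0 \<le> b" "0 \<le> c"
    by (simp_all add: a_b_c_def)
  have e: "energy k Q\<^sub>0 Q\<^sub>0 = ennreal a" "energy k Q Q\<^sub>0 = ennreal b" "energy k Q Q = ennreal c"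
    using fin by (simp_all add: a_b_c_def)
  \<comment> \<open>Linearity was shown in the first argument only; symmetry transfers it to the
    second and merges both cross terms into \<open>b\<close>.\<close>
  have "energy k ?S ?S = ennreal (1 - t) * energy k ?S Q\<^sub>0 + ennreal t * energy k ?S Q"
    using left[OF S] energy_commute[OF S] Q by simp
  also have "\<dots> = ennreal ((1 - t) * ((1 - t) * a + t * b) + t * ((1 - t) * b + t * c))"
    using t nn energy_commute[OF Q]
    by (simp add: left Q e flip: ennreal_mult ennreal_plus)
  also have "(1 - t) * ((1 - t) * a + t * b) + t * ((1 - t) * b + t * c) =
      (1 - t)\<^sup>2 * a + 2 * t * (1 - t) * b + t\<^sup>2 * c"
    by (simp add: power2_eq_square algebra_simps)
  finally show ?thesis
    by (simp add: a_b_c_def)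
qed

end

section \<open>Flat derivatives, critical points and local minimizers\<close>

lemma ereal_integral_enn2ereal:
  assumes "f \<in> borel_measurable M" "(\<integral>\<^sup>+ x. f x \<partial>M) < \<top>"
  shows "ereal_integrable M (\<lambda>x. enn2ereal (f x))"
    and "ereal_integral M (\<lambda>x. enn2ereal (f x)) = enn2real (\<integral>\<^sup>+ x. f x \<partial>M)"
proof -
  show "ereal_integrable M (\<lambda>x. enn2ereal (f x))"
    using assms by (simp add: ereal_integrable_def)
  have "AE x in M. f x \<noteq> \<top>"
    using nn_integral_PInf_AE[OF assms(1)] assms(2) by auto
  then have "AE x in M. f x = ennreal (enn2real (f x))"
    by eventually_elim (simp add: top.not_eq_extremum)
  then show "ereal_integral M (\<lambda>x. enn2ereal (f x)) = enn2real (\<integral>\<^sup>+ x. f x \<partial>M)"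
    using assms unfolding ereal_integral_def enn2real_def[symmetric]
    by (intro enn2real_nn_integral_eq_integral[symmetric]) auto
qed

text \<open>Along a segment the energy is a quadratic polynomial in \<open>t\<close>. The factor 2
  in the derivative comes from the two equal cross terms, and finite mixed energies make the
  derivative integrable.\<close>

lemma has_flat_derivative_energy:
  fixes k :: "'a::second_countable_topology \<Rightarrow> 'a \<Rightarrow> ennreal"
  assumes k: "symmetric_kernel k"
    and J: "\<And>Q. Q \<in> prob_measures \<Longrightarrow> J Q = energy k Q Q"
    and fin: "\<And>P Q. P \<in> dom_prob J \<Longrightarrow> Q \<in> dom_prob J \<Longrightarrow> energy k P Q < \<top>"
    and Q\<^sub>0: "Q\<^sub>0 \<in> dom_prob J"
  shows "has_flat_derivative J Q\<^sub>0 (\<lambda>x. enn2ereal (2 * (\<integral>\<^sup>+ z. k x z \<partial>Q\<^sub>0)))"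
    and "Q \<in> dom_prob J \<Longrightarrow> pairing (\<lambda>x. enn2ereal (2 * (\<integral>\<^sup>+ z. k x z \<partial>Q\<^sub>0))) Q Q\<^sub>0 =
      2 * (enn2real (energy k Q Q\<^sub>0) - enn2real (energy k Q\<^sub>0 Q\<^sub>0))"
proof -
  interpret symmetric_kernel k by fact
  define g where "g x = 2 * (\<integral>\<^sup>+ z. k x z \<partial>Q\<^sub>0)" for x
  have dom: "P \<in> prob_measures" if "P \<in> dom_prob J" for P
    using that by (simp add: dom_prob_def)
  have meas: "(\<lambda>x. \<integral>\<^sup>+ z. k x z \<partial>Q\<^sub>0) \<in> borel_measurable P" if "P \<in> dom_prob J" for P
    using kernel_integral_measurable dom that Q\<^sub>0 by blast
  have g_meas: "g \<in> borel_measurable P" if "P \<in> dom_prob J" for P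
    unfolding g_def using meas[OF that] by measurable
  have int_g: "(\<integral>\<^sup>+ x. g x \<partial>P) = 2 * energy k P Q\<^sub>0" if "P \<in> dom_prob J" for P
    unfolding g_def energy_def by (rule nn_integral_cmult[OF meas[OF that]])
  have int_g_fin: "(\<integral>\<^sup>+ x. g x \<partial>P) < \<top>" if "P \<in> dom_prob J" for P
    using fin[OF that Q\<^sub>0] by (simp add: int_g[OF that] ennreal_mult_less_top)
  note g = ereal_integral_enn2ereal[OF g_meas int_g_fin]
  have pairing: "pairing (\<lambda>x. enn2ereal (g x)) P Q\<^sub>0 =
      2 * (enn2real (energy k P Q\<^sub>0) - enn2real (energy k Q\<^sub>0 Q\<^sub>0))" if "P \<in> dom_prob J" for P
    using that Q\<^sub>0 by (simp add: pairing_def g int_g enn2real_mult)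
  then show "Q \<in> dom_prob J \<Longrightarrow> pairing (\<lambda>x. enn2ereal (2 * (\<integral>\<^sup>+ z. k x z \<partial>Q\<^sub>0))) Q Q\<^sub>0 =
      2 * (enn2real (energy k Q Q\<^sub>0) - enn2real (energy k Q\<^sub>0 Q\<^sub>0))"
    by (simp add: g_def)
  have "((\<lambda>t. (enn2ereal (J (segment_measure Q\<^sub>0 P t)) - enn2ereal (J Q\<^sub>0)) / ereal t)
           \<longlongrightarrow> ereal (pairing (\<lambda>x. enn2ereal (g x)) P Q\<^sub>0)) (at_right 0)" if P: "P \<in> dom_prob J" for P
  proof -
    define a b c where "a = enn2real (energy k Q\<^sub>0 Q\<^sub>0)" "b = enn2real (energy k P Q\<^sub>0)"
      "c = enn2real (energy k P P)"
    have nn: "0 \<le> a" "0 \<le> b" "0 \<le> c"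
      by (simp_all add: a_b_c_def)
    have a: "energy k Q\<^sub>0 Q\<^sub>0 = ennreal a"
      using fin[OF Q\<^sub>0 Q\<^sub>0] by (simp add: a_b_c_def)
    \<comment> \<open>After cancelling \<open>t\<close>, the difference quotient equals this affine
      function exactly on \<open>(0, 1)\<close>.\<close>
    have "((\<lambda>t. 2 * (b - a) + t * (a - 2 * b + c)) \<longlongrightarrow> 2 * (b - a) + 0 * (a - 2 * b + c)) (at_right 0)"
      by (intro tendsto_intros)
    then have "((\<lambda>t. ereal (2 * (b - a) + t * (a - 2 * b + c))) \<longlongrightarrow> ereal (2 * (b - a))) (at_right 0)"
      by simp
    moreover have "\<forall>\<^sub>F t in at_right (0::real). t \<in> {0<..<1}"
      by (rule eventually_at_right_real) simp
    then have "\<forall>\<^sub>F t in at_right 0. (enn2ereal (J (segment_measure Q\<^sub>0 P t)) - enn2ereal (J Q\<^sub>0)) / ereal t =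
        ereal (2 * (b - a) + t * (a - 2 * b + c))"
    proof eventually_elim
      case (elim t)
      then have t: "0 < t" "0 \<le> t" "t \<le> 1" by auto
      have "J (segment_measure Q\<^sub>0 P t) = ennreal ((1 - t)\<^sup>2 * a + 2 * t * (1 - t) * b + t\<^sup>2 * c)"
        using energy_segment[OF dom[OF Q\<^sub>0] dom[OF P] t(2,3)] fin P Q\<^sub>0
          segment_measure_in_prob_measures[OF dom[OF Q\<^sub>0] dom[OF P] t(2,3)]
        by (simp add: J a_b_c_def)
      \<comment> \<open>Nonnegativity excludes truncation by \<open>ennreal\<close> when passing to
        \<open>ereal\<close>.\<close>
      moreover have "0 \<le> (1 - t)\<^sup>2 * a + 2 * t * (1 - t) * b + t\<^sup>2 * c"
        using nn t by (intro add_nonneg_nonneg mult_nonneg_nonneg) auto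
      ultimately have "enn2ereal (J (segment_measure Q\<^sub>0 P t)) =
          ereal ((1 - t)\<^sup>2 * a + 2 * t * (1 - t) * b + t\<^sup>2 * c)"
        by (simp only: enn2ereal_ennreal)
      moreover have "enn2ereal (J Q\<^sub>0) = ereal a"
        using nn by (simp only: J[OF dom[OF Q\<^sub>0]] a enn2ereal_ennreal)
      moreover have "((1 - t)\<^sup>2 * a + 2 * t * (1 - t) * b + t\<^sup>2 * c - a) / t =
          2 * (b - a) + t * (a - 2 * b + c)"
        using t by (simp add: field_simps power2_eq_square)
      ultimately show ?case
        using t by simp
    qed
    ultimately show ?thesis
      unfolding pairing[OF P] a_b_c_def[symmetric] by (simp add: tendsto_cong)
  qed
  moreover have "(\<lambda>x. enn2ereal (g x)) \<in> borel_measurable borel"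
    using g_meas[OF Q\<^sub>0] dom[OF Q\<^sub>0] measurable_cong_sets[of Q\<^sub>0 borel]
    by (auto simp: mem_prob_measures)
  ultimately show "has_flat_derivative J Q\<^sub>0 (\<lambda>x. enn2ereal (2 * (\<integral>\<^sup>+ z. k x z \<partial>Q\<^sub>0)))"
    using g(1) Q\<^sub>0 unfolding has_flat_derivative_def g_def[symmetric] by blast
qed

text \<open>Both pairings are limits of the same difference quotient. This lets an arbitrary
  derivative in \<open>critical_point\<close> be replaced by the explicit one.\<close>

lemma pairing_unique:
  assumes "has_flat_derivative J Q\<^sub>0 G" "has_flat_derivative J Q\<^sub>0 G'" "Q \<in> dom_prob J"
  shows "pairing G Q Q\<^sub>0 = pairing G' Q Q\<^sub>0"
proof -
  have "ereal (pairing G Q Q\<^sub>0) = ereal (pairing G' Q Q\<^sub>0)"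
    using assms unfolding has_flat_derivative_def
    by (intro tendsto_unique[OF trivial_limit_at_right_real]) blast+
  then show ?thesis by simp
qed

text \<open>The pairing is twice a difference of two finite energies, so its sign compares
  them.\<close>

lemma critical_point_energy_iff:
  fixes k :: "'a::second_countable_topology \<Rightarrow> 'a \<Rightarrow> ennreal"
  assumes "symmetric_kernel k"
    and "\<And>Q. Q \<in> prob_measures \<Longrightarrow> J Q = energy k Q Q"
    and fin: "\<And>P Q. P \<in> dom_prob J \<Longrightarrow> Q \<in> dom_prob J \<Longrightarrow> energy k P Q < \<top>"
  shows "critical_point J P Q\<^sub>0 \<longleftrightarrow>
    Q\<^sub>0 \<in> dom_prob J \<inter> P \<and> (\<forall>Q \<in> dom_prob J \<inter> P. energy k Q\<^sub>0 Q\<^sub>0 \<le> energy k Q Q\<^sub>0)"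
proof (cases "Q\<^sub>0 \<in> dom_prob J")
  case True
  have deriv: "has_flat_derivative J Q\<^sub>0 (\<lambda>x. enn2ereal (2 * (\<integral>\<^sup>+ z. k x z \<partial>Q\<^sub>0)))"
    by (rule has_flat_derivative_energy(1)) (fact assms True)+
  have pairing: "pairing (\<lambda>x. enn2ereal (2 * (\<integral>\<^sup>+ z. k x z \<partial>Q\<^sub>0))) Q Q\<^sub>0 =
      2 * (enn2real (energy k Q Q\<^sub>0) - enn2real (energy k Q\<^sub>0 Q\<^sub>0))" if "Q \<in> dom_prob J" for Q
    by (rule has_flat_derivative_energy(2)) (fact assms True that)+
  have "0 \<le> pairing (\<lambda>x. enn2ereal (2 * (\<integral>\<^sup>+ z. k x z \<partial>Q\<^sub>0))) Q Q\<^sub>0 \<longleftrightarrow>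
      energy k Q\<^sub>0 Q\<^sub>0 \<le> energy k Q Q\<^sub>0" if "Q \<in> dom_prob J" for Q
    using fin[OF True True] fin[OF that True] pairing[OF that]
    by (cases "energy k Q\<^sub>0 Q\<^sub>0"; cases "energy k Q Q\<^sub>0") auto
  then show ?thesis
    using deriv pairing_unique[OF _ deriv] True
    unfolding critical_point_def by (metis IntD1)
qed (simp add: critical_point_def)

text \<open>For small \<open>t\<close> the segment towards an admissible \<open>Q\<close> stays in
  the neighbourhood, so the difference quotients are nonnegative, and so is their limit.\<close>

lemma local_minimizer_imp_critical_point:
  assumes deriv: "has_flat_derivative J Q\<^sub>0 G" and P: "P \<subseteq> prob_measures"
    and segment: "\<And>Q t. Q \<in> P \<Longrightarrow> 0 \<le> t \<Longrightarrow> t \<le> 1 \<Longrightarrow> segment_measure Q\<^sub>0 Q t \<in> P"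
    and min: "local_minimizer J P Q\<^sub>0"
  shows "critical_point J P Q\<^sub>0"
proof -
  obtain V where Q\<^sub>0: "Q\<^sub>0 \<in> P" and V: "openin (subtopology weak_topology P) V" "Q\<^sub>0 \<in> V"
    and J: "\<And>Q. Q \<in> V \<Longrightarrow> J Q\<^sub>0 \<le> J Q"
    using min unfolding local_minimizer_def by blast
  obtain T where T: "openin weak_topology T" "V = T \<inter> P"
    using V(1) unfolding openin_subtopology by blast
  have fin: "Q\<^sub>0 \<in> dom_prob J"
    using deriv by (simp add: has_flat_derivative_def)
  have "0 \<le> pairing G Q Q\<^sub>0" if Q: "Q \<in> dom_prob J \<inter> P" for Q
  proof -
    have "\<forall>\<^sub>F t in at_right (0::real). t \<in> {0<..<1}"
      by (rule eventually_at_right_real) simp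
    moreover have "\<forall>\<^sub>F t in at_right 0. segment_measure Q\<^sub>0 Q t \<in> T"
      using P Q Q\<^sub>0 V(2) T by (intro segment_measure_tendsto) auto
    ultimately have "\<forall>\<^sub>F t in at_right 0.
        0 \<le> (enn2ereal (J (segment_measure Q\<^sub>0 Q t)) - enn2ereal (J Q\<^sub>0)) / ereal t"
    proof eventually_elim
      case (elim t)
      then have "segment_measure Q\<^sub>0 Q t \<in> V"
        using T(2) Q by (auto intro: segment)
      then have "enn2ereal (J Q\<^sub>0) \<le> enn2ereal (J (segment_measure Q\<^sub>0 Q t))"
        using J by (simp add: less_eq_ennreal.rep_eq)
      \<comment> \<open>\<open>J\<close> may be infinite along the segment; finiteness at
        \<open>Q\<^sub>0\<close> keeps the extended-real difference well behaved.\<close>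
      moreover have "\<bar>enn2ereal (J Q\<^sub>0)\<bar> \<noteq> \<infinity>"
        using fin by (cases "J Q\<^sub>0") (auto simp: dom_prob_def enn2ereal_ennreal)
      ultimately show ?case
        using elim by (intro zero_le_divide_ereal) (auto simp: ereal_diff_positive)
    qed
    moreover have "((\<lambda>t. (enn2ereal (J (segment_measure Q\<^sub>0 Q t)) - enn2ereal (J Q\<^sub>0)) / ereal t)
           \<longlongrightarrow> ereal (pairing G Q Q\<^sub>0)) (at_right 0)"
      using deriv Q by (simp add: has_flat_derivative_def)
    ultimately have "0 \<le> ereal (pairing G Q Q\<^sub>0)"
      by (intro tendsto_lowerbound) auto
    then show ?thesis by simp
  qed
  then show ?thesis
    using deriv fin Q\<^sub>0 by (auto simp: critical_point_def)
qed

section \<open>Equilibria\<close>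

locale nag =
  fixes \<pi> :: "'x::polish_space \<Rightarrow> 'y::polish_space"
    and L :: "'x \<Rightarrow> ennreal" and H :: "'x \<Rightarrow> 'x \<Rightarrow> ennreal"
    and \<kappa> C :: real
  assumes \<pi>_continuous: "continuous_on UNIV \<pi>"
    and L_lsc: "lower_semicontinuous L"
    and H_measurable: "(\<lambda>(x, z). H x z) \<in> borel_measurable borel"
    and H_sym: "H x z = H z x"
    and kernel_lsc: "lower_semicontinuous (\<lambda>(x, z). L x + L z + H x z)"
    and fibre: "\<exists>x. \<pi> x = y \<and> L x \<le> ennreal \<kappa>"
    and L_compact: "0 < r \<Longrightarrow> compact {x. L x \<le> ennreal r}"
    and H_bound: "H x z \<le> ennreal C * (L x + L z + 1)"
begin

abbreviation kernel :: "'x \<Rightarrow> 'x \<Rightarrow> ennreal" where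
  "kernel x z \<equiv> L x + L z + H x z"

abbreviation mean_L :: "'x measure \<Rightarrow> ennreal" where
  "mean_L Q \<equiv> \<integral>\<^sup>+ x. L x \<partial>Q"

abbreviation cost :: "'x \<Rightarrow> 'x measure \<Rightarrow> ennreal" where
  "cost \<equiv> individual_cost L H"

text \<open>The set \<open>D\<close> serves the selection theorem, which asks when minimisers lie in
  a given closed set. A fibre that misses \<open>D\<close> has value \<open>\<top>\<close>.\<close>

abbreviation value_on :: "'x set \<Rightarrow> 'x measure \<Rightarrow> 'y \<Rightarrow> ennreal" where
  "value_on D Q y \<equiv> INF x \<in> {x \<in> D. \<pi> x = y}. cost x Q"

sublocale symmetric_kernel kernel
proof
  show "(\<lambda>(x, z). kernel x z) \<in> borel_measurable borel"
    by (rule lower_semicontinuous_measurable[OF kernel_lsc])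
  show "kernel x z = kernel z x" for x z
    by (simp add: H_sym[of x z] add.commute)
qed

section \<open>Measurability and finiteness of costs and energies\<close>

lemma borel_to_prob: "f \<in> borel_measurable borel \<Longrightarrow> Q \<in> prob_measures \<Longrightarrow> f \<in> borel_measurable Q"
  using measurable_cong_sets[of Q borel] by (auto simp: mem_prob_measures)

lemma L_measurable: "Q \<in> prob_measures \<Longrightarrow> L \<in> borel_measurable Q"
  by (rule borel_to_prob[OF lower_semicontinuous_measurable[OF L_lsc]])

lemma H_measurable_Pair:
  assumes "Q \<in> prob_measures" shows "H x \<in> borel_measurable Q"
proof -
  have "(\<lambda>(x, z). H x z) \<in> borel_measurable (borel \<Otimes>\<^sub>M borel)"
    using H_measurable by (simp only: borel_prod)
  from measurable_compose_Pair1[OF _ this, of x] have "H x \<in> borel_measurable borel"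
    by simp
  then show ?thesis
    using assms by (rule borel_to_prob)
qed

lemma cost_measurable:
  assumes Q: "Q \<in> prob_measures" shows "(\<lambda>x. cost x Q) \<in> borel_measurable borel"
proof -
  interpret prob_space Q using Q by (simp add: mem_prob_measures)
  have "(\<lambda>(x, z). H x z) \<in> borel_measurable (borel \<Otimes>\<^sub>M Q)"
    using Q by (intro borel_measurable_pair_borel H_measurable) (auto simp: mem_prob_measures)
  from borel_measurable_nn_integral[OF this] lower_semicontinuous_measurable[OF L_lsc]
  show ?thesis
    unfolding individual_cost_def by (rule borel_measurable_add[rotated])
qed

lemma kernel_integral:
  assumes Q: "Q \<in> prob_measures"
  shows "(\<integral>\<^sup>+ z. kernel x z \<partial>Q) = cost x Q + mean_L Q"
proof -
  interpret prob_space Q using Q by (simp add: mem_prob_measures)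
  show ?thesis
    using L_measurable[OF Q] H_measurable_Pair[OF Q]
    by (simp add: nn_integral_add emeasure_space_1 individual_cost_def ac_simps)
qed

lemma energy_kernel:
  assumes P: "P \<in> prob_measures" and Q: "Q \<in> prob_measures"
  shows "energy kernel P Q = (\<integral>\<^sup>+ x. cost x Q \<partial>P) + mean_L Q"
proof -
  interpret prob_space P using P by (simp add: mem_prob_measures)
  show ?thesis
    using borel_to_prob[OF cost_measurable[OF Q] P]
    by (simp add: energy_def kernel_integral[OF Q] nn_integral_add emeasure_space_1)
qed

lemma potential_eq_energy: "Q \<in> prob_measures \<Longrightarrow> potential L H Q = energy kernel Q Q"
  unfolding potential_def by (rule nn_integral_pair_eq_energy)

lemma L_le_cost: "L x \<le> cost x Q"
  by (simp add: individual_cost_def)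

lemma cost_le:
  assumes Q: "Q \<in> prob_measures"
  shows "cost x Q \<le> L x + ennreal C * (L x + mean_L Q + 1)"
proof -
  interpret prob_space Q using Q by (simp add: mem_prob_measures)
  have "(\<integral>\<^sup>+ z. H x z \<partial>Q) \<le> (\<integral>\<^sup>+ z. ennreal C * (L x + L z + 1) \<partial>Q)"
    by (intro nn_integral_mono H_bound)
  also have "\<dots> = ennreal C * (L x + mean_L Q + 1)"
    using L_measurable[OF Q] by (simp add: nn_integral_cmult nn_integral_add emeasure_space_1)
  finally show ?thesis
    unfolding individual_cost_def by (rule add_left_mono)
qed

lemma mean_cost_finite:
  assumes P: "P \<in> prob_measures" "mean_L P < \<top>" and Q: "Q \<in> prob_measures" "mean_L Q < \<top>"
  shows "(\<integral>\<^sup>+ x. cost x Q \<partial>P) < \<top>"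
proof -
  interpret prob_space P using P by (simp add: mem_prob_measures)
  have "(\<integral>\<^sup>+ x. cost x Q \<partial>P) \<le> (\<integral>\<^sup>+ x. L x + ennreal C * (L x + mean_L Q + 1) \<partial>P)"
    by (intro nn_integral_mono cost_le Q)
  also have "\<dots> = mean_L P + ennreal C * (mean_L P + mean_L Q + 1)"
    using L_measurable[OF P(1)] by (simp add: nn_integral_cmult nn_integral_add emeasure_space_1)
  also have "\<dots> < \<top>"
    using P(2) Q(2) by (simp add: ennreal_mult_less_top)
  finally show ?thesis .
qed

text \<open>The energy is the mean cost plus \<open>mean_L Q\<close>, which gives one direction; the
  growth bound on \<open>H\<close> gives the other. The domain thus depends on \<open>L\<close>
  alone, which makes mixed energies finite too.\<close>

lemma dom_potential_iff:
  assumes "Q \<in> prob_measures" shows "Q \<in> dom_prob (potential L H) \<longleftrightarrow> mean_L Q < \<top>"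
  using assms mean_cost_finite[of Q Q]
  by (auto simp: dom_prob_def potential_eq_energy energy_kernel)

lemma energy_finite:
  assumes "P \<in> dom_prob (potential L H)" "Q \<in> dom_prob (potential L H)"
  shows "energy kernel P Q < \<top>"
proof -
  have "P \<in> prob_measures" "Q \<in> prob_measures"
    using assms by (auto simp: dom_prob_def)
  with assms show ?thesis
    by (simp add: dom_potential_iff energy_kernel mean_cost_finite)
qed

text \<open>Lower semicontinuity is available for the whole kernel rather than for \<open>H\<close>,
  so the kernel is integrated and the finite constant \<open>mean_L Q\<close> is cancelled
  afterwards.\<close>

lemma cost_lsc:
  assumes Q: "Q \<in> prob_measures" "mean_L Q < \<top>"
  shows "lower_semicontinuous (\<lambda>x. cost x Q)"
proof -
  have "lower_semicontinuous (\<lambda>x. cost x Q + mean_L Q)"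
    using lower_semicontinuous_nn_integral[OF kernel_lsc, of Q] Q(1)
    unfolding kernel_integral[OF Q(1)] by (simp add: mem_prob_measures)
  then have "open {x. a + mean_L Q < cost x Q + mean_L Q}" for a
    unfolding lower_semicontinuous_def by blast
  then show ?thesis
    using Q(2)[THEN less_imp_neq] by (simp add: lower_semicontinuous_def ennreal_add_left_cancel_less
        add.commute[of _ "mean_L Q"])
qed

lemma cost_compact:
  assumes Q: "Q \<in> prob_measures" "mean_L Q < \<top>" and a: "a < \<top>"
  shows "compact {x. cost x Q \<le> a}"
proof -
  obtain s where s: "a = ennreal s" "0 \<le> s"
    using a by (cases a) auto
  \<comment> \<open>The level \<open>s + 1\<close> is positive, as \<open>L_compact\<close> demands,
    even when \<open>s = 0\<close>.\<close>
  have "compact ({x. L x \<le> ennreal (s + 1)} \<inter> {x. cost x Q \<le> a})"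
    using s by (intro compact_Int_closed L_compact lower_semicontinuous_closed[OF cost_lsc[OF Q]]) simp
  moreover have "L x \<le> ennreal (s + 1)" if "cost x Q \<le> a" for x
  proof -
    have "L x \<le> a"
      using L_le_cost that by (rule order.trans)
    also have "a \<le> ennreal (s + 1)"
      using s by (simp add: ennreal_leI)
    finally show ?thesis .
  qed
  then have "{x. L x \<le> ennreal (s + 1)} \<inter> {x. cost x Q \<le> a} = {x. cost x Q \<le> a}" by blast
  ultimately show ?thesis by simp
qed

section \<open>The value function and optimal selections\<close>

lemma value_lsc:
  assumes "Q \<in> prob_measures" "mean_L Q < \<top>" "closed D"
  shows "lower_semicontinuous (value_on D Q)"
  using assms by (intro lower_semicontinuous_fibre_inf \<pi>_continuous cost_lsc cost_compact)

text \<open>Every fibre contains a point with \<open>L\<close> at most \<open>\<kappa>\<close>, and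
  \<open>cost_le\<close> bounds its cost uniformly in \<open>y\<close>.\<close>

lemma value_bounded:
  assumes Q: "Q \<in> prob_measures" "mean_L Q < \<top>"
  obtains b where "b < \<top>" "\<And>y. value_on UNIV Q y \<le> b"
proof
  define b where "b = ennreal \<kappa> + ennreal C * (ennreal \<kappa> + mean_L Q + 1)"
  then show "b < \<top>"
    using Q(2) by (simp add: ennreal_mult_less_top)
  fix y
  obtain x where x: "\<pi> x = y" "L x \<le> ennreal \<kappa>" using fibre by blast
  have "value_on UNIV Q y \<le> cost x Q"
    using x by (intro INF_lower) simp
  also have "\<dots> \<le> L x + ennreal C * (L x + mean_L Q + 1)"
    by (rule cost_le[OF Q(1)])
  also have "\<dots> \<le> b"
    unfolding b_def using x(2) by (intro add_mono mult_left_mono) auto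
  finally show "value_on UNIV Q y \<le> b" .
qed

lemma value_attained:
  assumes Q: "Q \<in> prob_measures" "mean_L Q < \<top>" and D: "closed D" and fin: "value_on D Q y < \<top>"
  obtains x where "x \<in> D" "\<pi> x = y" "cost x Q = value_on D Q y"
proof -
  have "closed (D \<inter> \<pi> -` {y})"
    using \<pi>_continuous D by (intro closed_Int closed_vimage) auto
  also have "D \<inter> \<pi> -` {y} = {x \<in> D. \<pi> x = y}" by auto
  finally have "closed {x \<in> D. \<pi> x = y}" .
  from lower_semicontinuous_attains_inf[OF cost_lsc[OF Q] cost_compact[OF Q] this fin]
  show ?thesis using that by blast
qed

lemma value_le_cost: "value_on UNIV Q (\<pi> x) \<le> cost x Q"
  by (rule INF_lower) simp

text \<open>The minimisers over each fibre form a nonempty compact set. It meets a closed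
  \<open>D\<close> iff minimising over \<open>D\<close> costs no more than over the fibre, a
  comparison of two lower semicontinuous, hence Borel, functions.\<close>

lemma optimal_selection:
  assumes Q: "Q \<in> prob_measures" "mean_L Q < \<top>"
  obtains S where "S \<in> borel_measurable borel" "\<And>y. \<pi> (S y) = y"
    "\<And>y. cost (S y) Q = value_on UNIV Q y"
proof -
  define \<Phi> where "\<Phi> y = {x. \<pi> x = y \<and> cost x Q \<le> value_on UNIV Q y}" for y
  obtain b where b: "b < \<top>" "\<And>y. value_on UNIV Q y \<le> b"
    by (rule value_bounded[OF Q]) blast
  have fin: "value_on UNIV Q y < \<top>" for y
    using b(2) b(1) by (rule order.strict_trans1)
  have "compact (\<Phi> y)" for y
  proof -
    have "compact ({x. cost x Q \<le> value_on UNIV Q y} \<inter> \<pi> -` {y})"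
      using \<pi>_continuous by (intro compact_Int_closed cost_compact[OF Q fin] closed_vimage) auto
    also have "{x. cost x Q \<le> value_on UNIV Q y} \<inter> \<pi> -` {y} = \<Phi> y"
      by (auto simp: \<Phi>_def)
    finally show ?thesis .
  qed
  moreover have "\<Phi> y \<noteq> {}" for y
  proof -
    obtain x where "\<pi> x = y" "cost x Q = value_on UNIV Q y"
      using value_attained[OF Q closed_UNIV fin] by metis
    then show ?thesis unfolding \<Phi>_def by force
  qed
  moreover have "{y \<in> space borel. \<Phi> y \<inter> D \<noteq> {}} \<in> sets borel" if D: "closed D" for D
  proof -
    have "\<Phi> y \<inter> D \<noteq> {} \<longleftrightarrow> value_on D Q y \<le> value_on UNIV Q y" for y
    proof
      assume "\<Phi> y \<inter> D \<noteq> {}"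
      then obtain x where x: "x \<in> {x \<in> D. \<pi> x = y}" "cost x Q \<le> value_on UNIV Q y"
        by (auto simp only: \<Phi>_def)
      then show "value_on D Q y \<le> value_on UNIV Q y"
        by (rule INF_lower2)
    next
      assume le: "value_on D Q y \<le> value_on UNIV Q y"
      \<comment> \<open>A finite value guarantees that the infimum over \<open>D\<close> is
        attained.\<close>
      then have "value_on D Q y < \<top>"
        using fin by (rule order.strict_trans1)
      then obtain x where "x \<in> D" "\<pi> x = y" "cost x Q = value_on D Q y"
        by (rule value_attained[OF Q D])
      then show "\<Phi> y \<inter> D \<noteq> {}"
        using le by (auto simp only: \<Phi>_def)
    qed
    moreover have [measurable]: "value_on D Q \<in> borel_measurable borel"
      "value_on UNIV Q \<in> borel_measurable borel"
      by (intro lower_semicontinuous_measurable value_lsc Q D closed_UNIV)+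
    have "{y \<in> space borel. value_on D Q y \<le> value_on UNIV Q y} \<in> sets borel"
      by (rule borel_measurable_le) fact+
    ultimately show ?thesis by (simp only:)
  qed
  ultimately obtain S where S: "S \<in> borel_measurable borel" "\<forall>y \<in> space borel. S y \<in> \<Phi> y"
    by (rule measurable_selection[of borel \<Phi>]) blast+
  have "\<pi> (S y) = y" "cost (S y) Q \<le> value_on UNIV Q y" for y
    using S(2) by (simp_all add: \<Phi>_def)
  moreover from this have "cost (S y) Q = value_on UNIV Q y" for y
    using value_le_cost[of Q "S y"] by (metis order.antisym)
  ultimately show ?thesis
    using that S(1) by blast
qed

section \<open>Equilibria as minimisers of the mean cost\<close>

lemma integral_value:
  assumes Q: "Q \<in> prob_measures_over \<pi> m" and R: "R \<in> prob_measures" "mean_L R < \<top>"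
  shows "(\<lambda>x. value_on UNIV R (\<pi> x)) \<in> borel_measurable Q"
    and "(\<integral>\<^sup>+ x. value_on UNIV R (\<pi> x) \<partial>Q) = (\<integral>\<^sup>+ y. value_on UNIV R y \<partial>m)"
proof -
  have v: "value_on UNIV R \<in> borel_measurable borel"
    by (intro lower_semicontinuous_measurable value_lsc R closed_UNIV)
  have \<pi>: "\<pi> \<in> Q \<rightarrow>\<^sub>M borel"
    using Q borel_measurable_continuous_onI[OF \<pi>_continuous] measurable_cong_sets[of Q borel]
    by (auto simp: prob_measures_over_def mem_prob_measures)
  show "(\<lambda>x. value_on UNIV R (\<pi> x)) \<in> borel_measurable Q"
    by (rule measurable_compose[OF \<pi> v])
  have m: "distr Q borel \<pi> = m"
    using Q by (simp add: prob_measures_over_def)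
  show "(\<integral>\<^sup>+ x. value_on UNIV R (\<pi> x) \<partial>Q) = (\<integral>\<^sup>+ y. value_on UNIV R y \<partial>m)"
    unfolding m[symmetric] by (rule nn_integral_distr[OF \<pi>, symmetric])
      (use v in \<open>simp only: measurable_distr_eq1\<close>)
qed

lemma equilibrium_iff_minimises_cost:
  assumes Q\<^sub>0: "Q\<^sub>0 \<in> prob_measures_over \<pi> m" and m: "m \<in> prob_measures"
  shows "nag_equilibrium \<pi> L H m Q\<^sub>0 \<longleftrightarrow> mean_L Q\<^sub>0 < \<top> \<and>
    (\<forall>Q \<in> prob_measures_over \<pi> m. mean_L Q < \<top> \<longrightarrow>
      (\<integral>\<^sup>+ x. cost x Q\<^sub>0 \<partial>Q\<^sub>0) \<le> (\<integral>\<^sup>+ x. cost x Q\<^sub>0 \<partial>Q))"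
    (is "_ \<longleftrightarrow> _ \<and> ?min")
proof -
  have prob: "Q\<^sub>0 \<in> prob_measures" and distr: "distr Q\<^sub>0 borel \<pi> = m"
    using Q\<^sub>0 by (auto simp: prob_measures_over_def)
  let ?v = "value_on UNIV Q\<^sub>0"
  have equilibrium_iff: "nag_equilibrium \<pi> L H m Q\<^sub>0 \<longleftrightarrow>
      (\<integral>\<^sup>+ x. cost x Q\<^sub>0 \<partial>Q\<^sub>0) < \<top> \<and> (AE x in Q\<^sub>0. cost x Q\<^sub>0 = ?v (\<pi> x))"
    using prob distr by (simp add: nag_equilibrium_def)
  have fin: "mean_L Q\<^sub>0 < \<top>" if "(\<integral>\<^sup>+ x. cost x Q\<^sub>0 \<partial>Q\<^sub>0) < \<top>"
    using nn_integral_mono[OF L_le_cost] that by (rule order.strict_trans1)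
  show ?thesis
  proof
    assume "nag_equilibrium \<pi> L H m Q\<^sub>0"
    then have "(\<integral>\<^sup>+ x. cost x Q\<^sub>0 \<partial>Q\<^sub>0) < \<top>" and AE: "AE x in Q\<^sub>0. cost x Q\<^sub>0 = ?v (\<pi> x)"
      by (simp_all only: equilibrium_iff)
    then have L: "mean_L Q\<^sub>0 < \<top>" by (intro fin)
    have "(\<integral>\<^sup>+ x. cost x Q\<^sub>0 \<partial>Q\<^sub>0) \<le> (\<integral>\<^sup>+ x. cost x Q\<^sub>0 \<partial>Q)"
      if Q: "Q \<in> prob_measures_over \<pi> m" for Q
    proof -
      have "(\<integral>\<^sup>+ x. cost x Q\<^sub>0 \<partial>Q\<^sub>0) = (\<integral>\<^sup>+ x. ?v (\<pi> x) \<partial>Q\<^sub>0)"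
        using AE by (rule nn_integral_cong_AE)
      \<comment> \<open>The integrand factors through \<open>\<pi>\<close>, and both measures have
        marginal \<open>m\<close>.\<close>
      also have "\<dots> = (\<integral>\<^sup>+ x. ?v (\<pi> x) \<partial>Q)"
        unfolding integral_value(2)[OF Q\<^sub>0 prob L] integral_value(2)[OF Q prob L] ..
      also have "\<dots> \<le> (\<integral>\<^sup>+ x. cost x Q\<^sub>0 \<partial>Q)"
        by (intro nn_integral_mono value_le_cost)
      finally show ?thesis .
    qed
    with L show "mean_L Q\<^sub>0 < \<top> \<and> ?min" by blast
  next
    assume min: "mean_L Q\<^sub>0 < \<top> \<and> ?min"
    then have L: "mean_L Q\<^sub>0 < \<top>" by blast
    obtain S where S: "S \<in> borel_measurable borel" "\<And>y. \<pi> (S y) = y" "\<And>y. cost (S y) Q\<^sub>0 = ?v y"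
      by (rule optimal_selection[OF prob L]) blast
    \<comment> \<open>This competitor sends the mass at \<open>y\<close> to the minimiser
      \<open>S y\<close>; it has marginal \<open>m\<close> because \<open>S\<close> is a section of
      \<open>\<pi>\<close>.\<close>
    define Q where "Q = distr m borel S"
    have S_m: "S \<in> m \<rightarrow>\<^sub>M borel"
      using S(1) m measurable_cong_sets[of m borel] by (auto simp: mem_prob_measures)
    have Q_prob: "Q \<in> prob_measures"
      using m S_m by (auto simp: Q_def mem_prob_measures intro: prob_space.prob_space_distr)
    have "distr Q borel \<pi> = distr m borel (\<pi> \<circ> S)"
      unfolding Q_def
      by (rule distr_distr[OF borel_measurable_continuous_onI[OF \<pi>_continuous] S_m])
    also have "\<dots> = m"
      using m S(2) by (simp add: comp_def mem_prob_measures distr_id2)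
    finally have Q: "Q \<in> prob_measures_over \<pi> m"
      using Q_prob by (simp add: prob_measures_over_def)
    have int_Q: "(\<integral>\<^sup>+ x. cost x Q\<^sub>0 \<partial>Q) = (\<integral>\<^sup>+ y. ?v y \<partial>m)"
      unfolding Q_def by (subst nn_integral_distr[OF S_m]) (simp_all add: cost_measurable[OF prob] S(3))
    obtain b where b: "b < \<top>" "\<And>y. ?v y \<le> b"
      by (rule value_bounded[OF prob L]) blast
    have "(\<integral>\<^sup>+ y. ?v y \<partial>m) \<le> (\<integral>\<^sup>+ y. b \<partial>m)"
      using b(2) by (rule nn_integral_mono)
    also have "\<dots> = b"
      using m prob_space.emeasure_space_1[of m] by (simp add: mem_prob_measures)
    finally have v_fin: "(\<integral>\<^sup>+ y. ?v y \<partial>m) < \<top>"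
      using b(1) by (rule order.strict_trans1)
    \<comment> \<open>The competitor may enter \<open>?min\<close> only with finite
      \<open>mean_L\<close>, which follows from \<open>L\<close> being below the cost and the value
      being bounded.\<close>
    have "mean_L Q \<le> (\<integral>\<^sup>+ x. cost x Q\<^sub>0 \<partial>Q)"
      by (intro nn_integral_mono L_le_cost)
    then have "mean_L Q < \<top>"
      using v_fin unfolding int_Q by (rule order.strict_trans1)
    then have le: "(\<integral>\<^sup>+ x. cost x Q\<^sub>0 \<partial>Q\<^sub>0) \<le> (\<integral>\<^sup>+ x. ?v (\<pi> x) \<partial>Q\<^sub>0)"
      using min Q unfolding integral_value(2)[OF Q\<^sub>0 prob L] int_Q[symmetric] by blast
    have meas: "(\<lambda>x. cost x Q\<^sub>0) \<in> borel_measurable Q\<^sub>0"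
      by (rule borel_to_prob[OF cost_measurable[OF prob] prob])
    note meas_v = integral_value(1)[OF Q\<^sub>0 prob L]
    have v_fin': "(\<integral>\<^sup>+ x. ?v (\<pi> x) \<partial>Q\<^sub>0) < \<top>"
      using v_fin unfolding integral_value(2)[OF Q\<^sub>0 prob L] .
    \<comment> \<open>Truncated subtraction is exact here because the value lies below the cost. A
      nonnegative function with zero integral vanishes almost everywhere.\<close>
    have "(\<integral>\<^sup>+ x. cost x Q\<^sub>0 - ?v (\<pi> x) \<partial>Q\<^sub>0) = (\<integral>\<^sup>+ x. cost x Q\<^sub>0 \<partial>Q\<^sub>0) - (\<integral>\<^sup>+ x. ?v (\<pi> x) \<partial>Q\<^sub>0)"
      using v_fin' by (intro nn_integral_diff meas meas_v AE_I2 value_le_cost) simp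
    also have "\<dots> = 0"
      by (rule diff_eq_0_ennreal[OF order.strict_trans1[OF le v_fin'] le])
    finally have "AE x in Q\<^sub>0. cost x Q\<^sub>0 - ?v (\<pi> x) = 0"
      using meas meas_v by (subst (asm) nn_integral_0_iff_AE) (auto intro: borel_measurable_minus_ennreal)
    then have "AE x in Q\<^sub>0. cost x Q\<^sub>0 = ?v (\<pi> x)"
      by eventually_elim (rule order.antisym[OF ennreal_minus_eq_0 value_le_cost])
    moreover have "(\<integral>\<^sup>+ x. cost x Q\<^sub>0 \<partial>Q\<^sub>0) < \<top>"
      using le v_fin' by (rule order.strict_trans1)
    ultimately show "nag_equilibrium \<pi> L H m Q\<^sub>0"
      by (simp only: equilibrium_iff)
  qed
qed

text \<open>The energy of \<open>Q\<close> against \<open>Q\<^sub>0\<close> is the mean cost plus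
  \<open>mean_L Q\<^sub>0\<close>; this finite constant cancels, so comparing energies amounts to
  comparing mean costs.\<close>

theorem equilibrium_iff_critical_point:
  assumes Q\<^sub>0: "Q\<^sub>0 \<in> prob_measures_over \<pi> m" and m: "m \<in> prob_measures"
  shows "nag_equilibrium \<pi> L H m Q\<^sub>0 \<longleftrightarrow>
    critical_point (potential L H) (prob_measures_over \<pi> m) Q\<^sub>0"
proof -
  have prob: "Q \<in> prob_measures" if "Q \<in> prob_measures_over \<pi> m" for Q
    using that by (simp add: prob_measures_over_def)
  have crit: "critical_point (potential L H) (prob_measures_over \<pi> m) Q\<^sub>0 \<longleftrightarrow>
      Q\<^sub>0 \<in> dom_prob (potential L H) \<inter> prob_measures_over \<pi> m \<and>
      (\<forall>Q \<in> dom_prob (potential L H) \<inter> prob_measures_over \<pi> m.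
        energy kernel Q\<^sub>0 Q\<^sub>0 \<le> energy kernel Q Q\<^sub>0)"
    by (rule critical_point_energy_iff)
      (fact symmetric_kernel_axioms potential_eq_energy energy_finite)+
  have "energy kernel Q\<^sub>0 Q\<^sub>0 \<le> energy kernel Q Q\<^sub>0 \<longleftrightarrow>
      (\<integral>\<^sup>+ x. cost x Q\<^sub>0 \<partial>Q\<^sub>0) \<le> (\<integral>\<^sup>+ x. cost x Q\<^sub>0 \<partial>Q)"
    if "Q \<in> prob_measures_over \<pi> m" "mean_L Q\<^sub>0 < \<top>" for Q
    using that Q\<^sub>0
    unfolding energy_kernel[OF prob[OF Q\<^sub>0] prob[OF Q\<^sub>0]]
      energy_kernel[OF prob[OF that(1)] prob[OF Q\<^sub>0]]
    by (subst (1 2) add.commute) (auto simp: ennreal_add_left_cancel_le)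
  then show ?thesis
    unfolding crit equilibrium_iff_minimises_cost[OF Q\<^sub>0 m]
    using Q\<^sub>0 prob dom_potential_iff by blast
qed

theorem local_minimizer_imp_equilibrium:
  assumes Q\<^sub>0: "Q\<^sub>0 \<in> dom_prob (potential L H)" and m: "m \<in> prob_measures"
    and min: "local_minimizer (potential L H) (prob_measures_over \<pi> m) Q\<^sub>0"
  shows "nag_equilibrium \<pi> L H m Q\<^sub>0"
proof -
  have over: "Q\<^sub>0 \<in> prob_measures_over \<pi> m"
    using min by (simp add: local_minimizer_def)
  have deriv: "has_flat_derivative (potential L H) Q\<^sub>0 (\<lambda>x. enn2ereal (2 * (\<integral>\<^sup>+ z. kernel x z \<partial>Q\<^sub>0)))"
    by (rule has_flat_derivative_energy(1))
      (fact symmetric_kernel_axioms potential_eq_energy energy_finite Q\<^sub>0)+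
  have "critical_point (potential L H) (prob_measures_over \<pi> m) Q\<^sub>0"
  proof (rule local_minimizer_imp_critical_point[OF deriv _ _ min])
    show "prob_measures_over \<pi> m \<subseteq> prob_measures"
      by (auto simp: prob_measures_over_def)
  qed (intro segment_measure_in_prob_measures_over borel_measurable_continuous_onI \<pi>_continuous over)
  then show ?thesis
    using equilibrium_iff_critical_point[OF over m] by blast
qed

end

theorem theorem3p23:
  fixes \<pi> :: "'x::polish_space \<Rightarrow> 'y::polish_space"
    and L :: "'x \<Rightarrow> ennreal"
    and H :: "'x \<Rightarrow> 'x \<Rightarrow> ennreal"
    and m\<^sub>0 :: "'y measure"
  assumes "continuous_on UNIV \<pi>"
    and "lower_semicontinuous L"
    and "(\<lambda>(x, z). H x z) \<in> borel_measurable borel"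
    and "m\<^sub>0 \<in> prob_measures"
    and "\<And>x z. H x z = H z x"
    and "lower_semicontinuous (\<lambda>(x, z). L x + L z + H x z)"
    and "\<exists>\<kappa>::real. \<kappa> > 0 \<and> (\<forall>y. \<exists>x. \<pi> x = y \<and> L x \<le> ennreal \<kappa>)"
    and "\<And>\<kappa>::real. \<kappa> > 0 \<Longrightarrow> compact {x. L x \<le> ennreal \<kappa>}"
    and "\<exists>C::real. C > 0 \<and> (\<forall>x z. H x z \<le> ennreal C * (L x + L z + 1))"
  shows "(\<forall>Q\<^sub>0 \<in> prob_measures_over \<pi> m\<^sub>0.
            nag_equilibrium \<pi> L H m\<^sub>0 Q\<^sub>0 \<longleftrightarrow>
            critical_point (potential L H) (prob_measures_over \<pi> m\<^sub>0) Q\<^sub>0) \<and>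
         (\<forall>Q\<^sub>0 \<in> dom_prob (potential L H).
            local_minimizer (potential L H) (prob_measures_over \<pi> m\<^sub>0) Q\<^sub>0 \<longrightarrow>
            nag_equilibrium \<pi> L H m\<^sub>0 Q\<^sub>0)"
proof -
  obtain \<kappa> C :: real where "\<And>y. \<exists>x. \<pi> x = y \<and> L x \<le> ennreal \<kappa>"
    and "\<And>x z. H x z \<le> ennreal C * (L x + L z + 1)"
    using assms(7,9) by blast
  then interpret nag \<pi> L H \<kappa> C
    using assms(1-3,5,6,8) by unfold_locales
  show ?thesis
    using equilibrium_iff_critical_point[OF _ assms(4)] local_minimizer_imp_equilibrium[OF _ assms(4)]
    by blast
qed

end
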